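(* Let $V:\mathbb{R}^d\times\Omega\to\mathbb{R}$ be a Gaussian process on a complete probability space $(\Omega,\mathscr{F},P)$ with mean $m\in C^3(\mathbb{R}^d)$ and covariance $k\in C^6(\mathbb{R}^d\times\mathbb{R}^d)$ having all partial derivatives up to order $6$ bounded, and with sample paths almost surely in $C^3(\mathbb{R}^d)$. Let $M\in\mathbb{R}^{d\times d}$ be symmetric positive definite and fix any $T>0$. Let the parameters $\alpha=\alpha(\delta t)$, $\beta=\beta(\delta t)$ satisfy, with $\alpha_1=\beta_1=0$, $$\alpha=1+\alpha_2\delta t^2+\widetilde\alpha(\delta t),\qquad \beta=1+\beta_2\delta t^2+\widetilde\beta(\delta t),$$ where $\alpha_2,\beta_2\in\mathbb{R}$ are independent of $\delta t$ and $|\widetilde\alpha(\delta t)|\le C_\alpha\delta t^3$, $|\widetilde\beta(\delta t)|\le C_\beta\delta t^3$ for all sufficiently small $\delta t>0$, with $C_\alpha,C_\beta>0$ independent of $\delta t$. Let $(y_n,x_n)$ be the iterates of the parameterized leapfrog scheme (see context), and assume there is $R>0$ such that $P\big(\sup_{0\le n\le T/\delta t}\|(y_n,x_n)\|\le R\big)=1$ for all sufficiently small $\delta t>0$. Let $(y(t),x(t))$ be the exact solution of the Hamiltonian system $\dot y=M^{-1}x$, $\dot x=-\nabla V(y;\omega)$ with $(y(0),x(0))=(y_0,x_0)$. Then the scheme converges with order $1$ in mean square to the exact solution: there is a constant $C_T$, depending on $T$ but not on $\delta t$, such that for all sufficiently small $\delta t>0$ with $T/\delta t\in\mathbb{N}$,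 $$\sqrt{\mathbb{E}\Big[\big\|(y(T),x(T))-(y_{T/\delta t},x_{T/\delta t})\big\|^2\Big]}\le C_T\,\delta t.$$
   Context: A Gaussian process is a stochastic process whose finite-dimensional distributions are multivariate Gaussian; $m(y)=\mathbb{E}[V(y)]$, $k(y,y')=\mathrm{Cov}(V(y),V(y'))$. $V$ is always the version with almost surely $C^3$ sample paths; $\nabla$ is the gradient in $y$; $\|\cdot\|$ is the Euclidean norm. The parameterized leapfrog scheme with step $\delta t>0$, started from an $\mathbb{R}^d\times\mathbb{R}^d$-valued initial value $(y_0,x_0)$ (a random vector, possibly constant, not depending on $\delta t$), is, for integers $n\ge0$, $$y_{n+1}=\beta y_n+\delta t\,M^{-1}\Big(\alpha x_n-\tfrac{\delta t}{2}\nabla V(y_n;\omega)\Big),\qquad x_{n+1}=\alpha^2x_n-\tfrac{\delta t}{2}\big(\alpha\nabla V(y_n;\omega)+\nabla V(y_{n+1};\omega)\big).$$ *)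

theory Defs
  imports "HOL-Probability.Probability"
begin

definition partial_deriv :: "'a::euclidean_space \<Rightarrow> ('a \<Rightarrow> real) \<Rightarrow> 'a \<Rightarrow> real"
  where "partial_deriv b f x = deriv (\<lambda>t. f (x + t *\<^sub>R b)) 0"

text \<open>A list of basis vectors encodes an iterated partial derivative; its length is the order.\<close>

definition partials :: "'a::euclidean_space list \<Rightarrow> ('a \<Rightarrow> real) \<Rightarrow> 'a \<Rightarrow> real"
  where "partials bs f = foldr partial_deriv bs f"

text \<open>The class $C^k$: all partial derivatives up to order $k$ exist and are continuous.
  Since \<^const>\<open>deriv\<close> is total, existence has to be demanded separately.\<close>

definition C_k :: "nat \<Rightarrow> ('a::euclidean_space \<Rightarrow> real) \<Rightarrow> bool"
  where "C_k k f \<longleftrightarrow>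
    (\<forall>bs. set bs \<subseteq> Basis \<longrightarrow>
       (length bs \<le> k \<longrightarrow> continuous_on UNIV (partials bs f)) \<and>
       (length bs < k \<longrightarrow>
          (\<forall>b\<in>Basis. \<forall>x. (\<lambda>t. partials bs f (x + t *\<^sub>R b)) differentiable (at 0))))"

text \<open>Orders $1,\dots,k$ only: the function itself need not be bounded.\<close>

definition bounded_partials :: "nat \<Rightarrow> ('a::euclidean_space \<Rightarrow> real) \<Rightarrow> bool"
  where "bounded_partials k f \<longleftrightarrow>
    (\<forall>bs. set bs \<subseteq> Basis \<and> 1 \<le> length bs \<and> length bs \<le> k \<longrightarrow> bounded (range (partials bs f)))"

definition gradient :: "('a::euclidean_space \<Rightarrow> real) \<Rightarrow> 'a \<Rightarrow> 'a"
  where "gradient f x = (\<Sum>b\<in>Basis. partial_deriv b f x *\<^sub>R b)"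

text \<open>Point masses are the Gaussians of variance $0$; \<^const>\<open>normal_density\<close> with zero
  standard deviation would give the zero measure instead.\<close>

definition gaussian :: "real measure \<Rightarrow> bool"
  where "gaussian \<nu> \<longleftrightarrow>
    (\<exists>\<mu>. \<nu> = return borel \<mu> \<or> (\<exists>\<sigma>>0. \<nu> = density lborel (normal_density \<mu> \<sigma>)))"

text \<open>A law on $\mathbb{R}^I$, $I$ finite, is multivariate Gaussian (possibly degenerate) if all
  its one-dimensional linear images are Gaussian.\<close>

definition multivariate_gaussian :: "'i set \<Rightarrow> ('i \<Rightarrow> real) measure \<Rightarrow> bool"
  where "multivariate_gaussian I \<nu> \<longleftrightarrow>
    sets \<nu> = sets (Pi\<^sub>M I (\<lambda>_. borel)) \<and>
    (\<forall>a :: 'i \<Rightarrow> real. gaussian (distr \<nu> borel (\<lambda>v. \<Sum>i\<in>I. a i * v i)))"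

definition gaussian_process :: "'w measure \<Rightarrow> ('i \<Rightarrow> 'w \<Rightarrow> real) \<Rightarrow> bool"
  where "gaussian_process P V \<longleftrightarrow>
    (\<forall>i. V i \<in> borel_measurable P) \<and>
    (\<forall>I. finite I \<longrightarrow>
       multivariate_gaussian I (distr P (Pi\<^sub>M I (\<lambda>_. borel)) (\<lambda>\<omega>. \<lambda>i\<in>I. V i \<omega>)))"

definition mean_fun :: "'w measure \<Rightarrow> ('i \<Rightarrow> 'w \<Rightarrow> real) \<Rightarrow> 'i \<Rightarrow> real"
  where "mean_fun P V y = (\<integral>\<omega>. V y \<omega> \<partial>P)"

definition cov_fun :: "'w measure \<Rightarrow> ('i \<Rightarrow> 'w \<Rightarrow> real) \<Rightarrow> 'i \<times> 'i \<Rightarrow> real"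
  where "cov_fun P V = (\<lambda>(y, y').
    \<integral>\<omega>. (V y \<omega> - mean_fun P V y) * (V y' \<omega> - mean_fun P V y') \<partial>P)"

definition sym_pos_def :: "real^'d^'d \<Rightarrow> bool"
  where "sym_pos_def M \<longleftrightarrow> transpose M = M \<and> (\<forall>v. v \<noteq> 0 \<longrightarrow> 0 < v \<bullet> (M *v v))"

definition leapfrog_step ::
  "real^'d^'d \<Rightarrow> (real^'d \<Rightarrow> real) \<Rightarrow> real \<Rightarrow> real \<Rightarrow> real \<Rightarrow>
   (real^'d) \<times> (real^'d) \<Rightarrow> (real^'d) \<times> (real^'d)"
  where "leapfrog_step M U a b dt = (\<lambda>(y, x).
    let y' = b *\<^sub>R y + dt *\<^sub>R (matrix_inv M *v (a *\<^sub>R x - (dt / 2) *\<^sub>R gradient U y))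
    in (y', a\<^sup>2 *\<^sub>R x - (dt / 2) *\<^sub>R (a *\<^sub>R gradient U y + gradient U y')))"

primrec leapfrog ::
  "real^'d^'d \<Rightarrow> (real^'d \<Rightarrow> real) \<Rightarrow> real \<Rightarrow> real \<Rightarrow> real \<Rightarrow>
   (real^'d) \<times> (real^'d) \<Rightarrow> nat \<Rightarrow> (real^'d) \<times> (real^'d)"
  where
    "leapfrog M U a b dt z 0 = z"
  | "leapfrog M U a b dt z (Suc n) = leapfrog_step M U a b dt (leapfrog M U a b dt z n)"

definition hamiltonian_solution ::
  "real^'d^'d \<Rightarrow> (real^'d \<Rightarrow> real) \<Rightarrow> real \<Rightarrow> (real^'d) \<times> (real^'d) \<Rightarrow>
   (real \<Rightarrow> real^'d) \<Rightarrow> (real \<Rightarrow> real^'d) \<Rightarrow> bool"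
  where "hamiltonian_solution M U T z y x \<longleftrightarrow>
    (y 0, x 0) = z \<and>
    (\<forall>t\<in>{0..T}.
       (y has_vector_derivative matrix_inv M *v x t) (at t within {0..T}) \<and>
       (x has_vector_derivative - gradient U (y t)) (at t within {0..T}))"

end

theory Submission
  imports Defs
begin

text \<open>
  Fix a realization of the potential. The iterates stay in the ball of radius R, and on that ball
  the force is bounded and Lipschitz, with constants that depend on the realization. One step of
  the scheme is an explicit Euler step up to terms of order dt squared, because
  the parameters differ from 1 only by terms of order dt squared and the scheme is consistent.
  The discrete Gronwall argument then gives an error of at most a polynomial in H times
  exp (2 H T) times dt, where H bounds all constants involved
  (\<open>leapfrog_error_bound\<close>). The exact solution is not assumed to stay in the ball. A first use of
  this estimate, with uncontrolled random constants on a larger ball, shows that the iterates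
  converge to the exact solution, so the solution does stay in the ball
  (\<open>leapfrog_converges\<close>); the second use, on the ball of radius R, gives the rate.

  What remains is to integrate the square of the random constant, that is, to show that
  exp (\<kappa> S) is integrable for every \<kappa> when S is the Lipschitz constant of the gradient of V on a ball.
  This is where Gaussianity enters. The Lipschitz constant is bounded by a supremum of
  countably many second difference quotients of V, which are linear functionals of V, so after
  subtraction of the mean they form a centred Gaussian family. The supremum is almost
  surely finite since the paths are twice continuously differentiable. By the theorem of
  Fernique an almost surely finite supremum of this kind has all exponential moments
  (\<open>fernique_exponential_moment\<close>, \<open>gaussian_gradient_lipschitz_exponential_moment\<close>).
  A bound for the size of the force requires no further functional of V: along a
  solution that stays in the ball the momentum changes by at most 2 R in time T, so each component of
  the force is at most 2 R / T at some time, and the Lipschitz constant controls it elsewhere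
  (\<open>force_bound_along_solution\<close>).

  Fernique's theorem rests on the rotation invariance of Gaussian laws: for independent copies
  X and X' the pair (X + X') / sqrt 2, (X - X') / sqrt 2 has the same law as (X, X').
  For laws of finite families this follows from equality of characteristic functions, and
  \<open>rectangles_determined_by_cosines\<close> reduces the uniqueness theorem in several dimensions to
  the theorem of Levy on the real line.
\<close>

section \<open>Finite families of random variables and their characteristic functions\<close>

text \<open>The weights f and g turn the uniqueness theorem of Levy into a statement about finite measures:
after normalization, f and g are densities of probability measures under which U and W have the
same characteristic function. The phase \<theta> combines its real and imaginary parts.\<close>

lemma weighted_char_determines_integral:
  fixes f g U W :: "'w \<Rightarrow> real"
  assumes [measurable]: "U \<in> borel_measurable Q" "W \<in> borel_measurable Q"
    and f: "integrable Q f" and g: "integrable Q g"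
    and f0: "\<And>\<omega>. 0 \<le> f \<omega>" and g0: "\<And>\<omega>. 0 \<le> g \<omega>"
    and eq: "\<And>l \<theta>. (\<integral>\<omega>. f \<omega> * cos (l * U \<omega> + \<theta>) \<partial>Q) = (\<integral>\<omega>. g \<omega> * cos (l * W \<omega> + \<theta>) \<partial>Q)"
    and [measurable]: "S \<in> sets borel"
  shows "(\<integral>\<omega>. f \<omega> * indicator S (U \<omega>) \<partial>Q) = (\<integral>\<omega>. g \<omega> * indicator S (W \<omega>) \<partial>Q)"
proof -
  define m where "m = integral\<^sup>L Q f"
  have mg: "m = integral\<^sup>L Q g" using eq[of 0 0] by (simp add: m_def)
  have "m \<ge> 0" unfolding m_def by (simp add: f0)
  show ?thesis
  proof (cases "m = 0")
    case True
    then have "AE \<omega> in Q. f \<omega> = 0" "AE \<omega> in Q. g \<omega> = 0"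
      using integral_nonneg_eq_0_iff_AE[OF f] integral_nonneg_eq_0_iff_AE[OF g] f0 g0
      unfolding m_def[symmetric] mg[symmetric] by auto
    then have "(\<integral>\<omega>. f \<omega> * indicator S (U \<omega>) \<partial>Q) = (\<integral>\<omega>. 0 \<partial>Q)"
        "(\<integral>\<omega>. g \<omega> * indicator S (W \<omega>) \<partial>Q) = (\<integral>\<omega>. 0 \<partial>Q)"
      using f g by (intro integral_cong_AE; auto)+
    then show ?thesis by simp
  next
    case False
    then have m: "m > 0" using \<open>m \<ge> 0\<close> by simp
    define law where "law h X = distr (density Q (\<lambda>\<omega>. ennreal (h \<omega> / m))) borel X"
      for h X :: "'w \<Rightarrow> real"
    have law: "real_distribution (law h X)"
        "char (law h X) l = Complex ((\<integral>\<omega>. h \<omega> * cos (l * X \<omega>) \<partial>Q) / m)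
           ((\<integral>\<omega>. h \<omega> * cos (l * X \<omega> - pi / 2) \<partial>Q) / m)"
        "measure (law h X) S = (\<integral>\<omega>. h \<omega> * indicator S (X \<omega>) \<partial>Q) / m"
      if h: "integrable Q h" "integral\<^sup>L Q h = m" "\<And>\<omega>. 0 \<le> h \<omega>"
        and [measurable]: "X \<in> borel_measurable Q" for h X l
    proof -
      have [measurable]: "h \<in> borel_measurable Q" using h by auto
      have "emeasure (density Q (\<lambda>\<omega>. ennreal (h \<omega> / m))) (space Q) = (\<integral>\<^sup>+\<omega>. ennreal (h \<omega> / m) \<partial>Q)"
        by (subst emeasure_density) (auto intro!: nn_integral_cong)
      also have "\<dots> = ennreal (\<integral>\<omega>. h \<omega> / m \<partial>Q)"
        using h m by (intro nn_integral_eq_integral) auto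
      also have "\<dots> = 1" using h m by simp
      finally have ps: "prob_space (density Q (\<lambda>\<omega>. ennreal (h \<omega> / m)))"
        by (intro prob_spaceI) simp
      then show rd: "real_distribution (law h X)"
        unfolding law_def by (intro prob_space.real_distribution_distr) auto
      interpret R: real_distribution "law h X" by fact
      have "char (law h X) l = (\<integral>\<omega>. (h \<omega> / m) *\<^sub>R iexp (l * X \<omega>) \<partial>Q)"
        unfolding char_def law_def using h m
        by (subst integral_distr; simp) (subst integral_density; simp)
      also have "\<dots> = (\<integral>\<omega>. (h \<omega> / m) *\<^sub>R Complex (cos (l * X \<omega>)) (cos (l * X \<omega> - pi / 2)) \<partial>Q)"
        by (intro Bochner_Integration.integral_cong) (auto simp: complex_eq_iff cos_diff Re_exp Im_exp)
      finally have c: "char (law h X) l = \<dots>" .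
      have int: "integrable Q (\<lambda>\<omega>. (h \<omega> / m) *\<^sub>R Complex (cos (l * X \<omega>)) (cos (l * X \<omega> - pi / 2)))"
      proof (rule Bochner_Integration.integrable_bound[of _ "\<lambda>\<omega>. h \<omega> / m"])
        have "Complex (cos t) (cos (t - pi / 2)) = cis t" for t
          by (simp add: complex_eq_iff cos_diff)
        then show "AE \<omega> in Q. norm ((h \<omega> / m) *\<^sub>R Complex (cos (l * X \<omega>)) (cos (l * X \<omega> - pi / 2))) \<le> norm (h \<omega> / m)"
          using m by simp
      qed (use h in \<open>auto simp: Complex_eq\<close>)
      show "char (law h X) l = Complex ((\<integral>\<omega>. h \<omega> * cos (l * X \<omega>) \<partial>Q) / m)
           ((\<integral>\<omega>. h \<omega> * cos (l * X \<omega> - pi / 2) \<partial>Q) / m)"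
        unfolding c using int m
        by (auto simp: complex_eq_iff simp flip: integral_Re integral_Im)
      have "measure (law h X) S = (\<integral>x. indicator S x \<partial>law h X)"
        by (simp add: law_def)
      also have "\<dots> = (\<integral>\<omega>. (h \<omega> / m) * indicator S (X \<omega>) \<partial>Q)"
        unfolding law_def using h m
        by (subst integral_distr; simp) (subst integral_density; simp)
      finally show "measure (law h X) S = (\<integral>\<omega>. h \<omega> * indicator S (X \<omega>) \<partial>Q) / m" by simp
    qed
    have "law f U = law g W"
      using eq[of _ 0] eq[of _ "- pi / 2"]
      by (intro Levy_uniqueness law(1) ext)
         (use f g f0 g0 mg in \<open>auto simp: law(2) m_def[symmetric]\<close>)
    then show ?thesis
      using law(3)[of f U] law(3)[of g W] f g f0 g0 mg m by (simp add: m_def[symmetric])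
  qed
qed

text \<open>A multidimensional uniqueness theorem without multidimensional Fourier inversion: the
coordinates are constrained one after the other. If the constraints for the coordinates in J
have been inserted as a weight and all cosine integrals still agree, then the one-dimensional
theorem for the coordinate j, with the nonnegative weight 1 + cos (...), allows the
constraint on j to be inserted as well. The product of two cosines is a sum of cosines, so the
hypothesis is preserved.\<close>

lemma rectangles_determined_by_cosines:
  fixes Z Z' :: "'k \<Rightarrow> 'w \<Rightarrow> real"
  assumes "prob_space Q" and fin: "finite K"
    and Z: "\<And>k. k \<in> K \<Longrightarrow> Z k \<in> borel_measurable Q"
    and Z': "\<And>k. k \<in> K \<Longrightarrow> Z' k \<in> borel_measurable Q"
    and eq: "\<And>a \<theta>. (\<integral>\<omega>. cos ((\<Sum>k\<in>K. a k * Z k \<omega>) + \<theta>) \<partial>Q) =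
                  (\<integral>\<omega>. cos ((\<Sum>k\<in>K. a k * Z' k \<omega>) + \<theta>) \<partial>Q)"
    and S: "\<And>k. k \<in> K \<Longrightarrow> S k \<in> sets borel"
  shows "measure Q {\<omega> \<in> space Q. \<forall>k\<in>K. Z k \<omega> \<in> S k} =
         measure Q {\<omega> \<in> space Q. \<forall>k\<in>K. Z' k \<omega> \<in> S k}"
proof -
  interpret prob_space Q by fact
  note [measurable] = Z Z' S
  define F where "F Y J \<omega> = (\<Prod>k\<in>J. indicator (S k) (Y k \<omega>) :: real)"
    for Y :: "'k \<Rightarrow> 'w \<Rightarrow> real" and J \<omega>
  define L where "L a Y \<omega> = (\<Sum>k\<in>K. a k * Y k \<omega>)" for a and Y :: "'k \<Rightarrow> 'w \<Rightarrow> real" and \<omega>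
  have [measurable]: "L a Z \<in> borel_measurable Q" "L a Z' \<in> borel_measurable Q" for a
    unfolding L_def by measurable
  have F01: "0 \<le> F Y J \<omega>" "F Y J \<omega> \<le> 1" for Y J \<omega>
    unfolding F_def by (auto intro!: prod_nonneg prod_le_1)
  have Fm[measurable]: "F Z J \<in> borel_measurable Q" "F Z' J \<in> borel_measurable Q" if "J \<subseteq> K" for J
    unfolding F_def using that by (auto intro!: borel_measurable_prod measurable_compose[OF Z] measurable_compose[OF Z'] borel_measurable_indicator)
  have "(\<integral>\<omega>. F Z J \<omega> * cos (L a Z \<omega> + \<theta>) \<partial>Q) = (\<integral>\<omega>. F Z' J \<omega> * cos (L a Z' \<omega> + \<theta>) \<partial>Q)"
    if "J \<subseteq> K" for J a \<theta>
    using finite_subset[OF that fin] that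
  proof (induction J arbitrary: a \<theta> rule: finite_induct)
    case empty
    then show ?case using eq by (simp add: F_def L_def)
  next
    case (insert j J)
    then have J: "J \<subseteq> K" and j: "j \<in> K" by auto
    note [measurable] = Fm[OF J] Z[OF j] Z'[OF j] S[OF j]
    have int: "integrable Q (\<lambda>\<omega>. F Z J \<omega> * cos (g \<omega>))" "integrable Q (\<lambda>\<omega>. F Z' J \<omega> * cos (g \<omega>))"
      if [measurable]: "g \<in> borel_measurable Q" for g
      by (rule integrable_const_bound[where B = 1];
          use F01 in \<open>auto simp: abs_mult intro!: mult_le_one\<close>)+
    have intF: "integrable Q (F Z J)" "integrable Q (F Z' J)"
      using int[of "\<lambda>_. 0"] by auto
    have intS: "integrable Q (\<lambda>\<omega>. F Z J \<omega> * indicator (S j) (Z j \<omega>))"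
        "integrable Q (\<lambda>\<omega>. F Z' J \<omega> * indicator (S j) (Z' j \<omega>))"
        "integrable Q (\<lambda>\<omega>. F Z J \<omega> * cos (L a Z \<omega> + \<theta>) * indicator (S j) (Z j \<omega>))"
        "integrable Q (\<lambda>\<omega>. F Z' J \<omega> * cos (L a Z' \<omega> + \<theta>) * indicator (S j) (Z' j \<omega>))" for a \<theta>
      by (rule integrable_const_bound[where B = 1];
          use F01 in \<open>auto simp: abs_mult intro!: mult_le_one\<close>)+
    define e where "e l = (\<lambda>_. 0)(j := l)" for l :: real
    have L1: "l * Y j \<omega> + \<theta> = L (e l) Y \<omega> + \<theta>" for l \<theta> \<omega> and Y :: "'k \<Rightarrow> 'w \<Rightarrow> real"
    proof -
      have "L (e l) Y \<omega> = (\<Sum>k\<in>K. if k = j then l * Y j \<omega> else 0)"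
        unfolding L_def e_def by (intro sum.cong) auto
      then show ?thesis using j fin by simp
    qed
    have L2: "L a Y \<omega> + c * L b Y \<omega> = L (\<lambda>k. a k + c * b k) Y \<omega>" for a b c \<omega> and Y :: "'k \<Rightarrow> 'w \<Rightarrow> real"
      by (simp add: L_def sum.distrib sum_distrib_left algebra_simps)
    have split: "F Y J \<omega> * (1 + cos (L a Y \<omega> + \<theta>)) * cos (l * Y j \<omega> + \<eta>) =
        F Y J \<omega> * cos (L (e l) Y \<omega> + \<eta>)
        + (F Y J \<omega> * cos (L (\<lambda>k. a k + 1 * e l k) Y \<omega> + (\<theta> + \<eta>)) / 2
        + F Y J \<omega> * cos (L (\<lambda>k. a k + (-1) * e l k) Y \<omega> + (\<theta> - \<eta>)) / 2)"
      for a \<theta> l \<eta> \<omega> and Y :: "'k \<Rightarrow> 'w \<Rightarrow> real"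
      unfolding L2[symmetric] L1 cos_add cos_diff sin_add sin_diff by (simp add: field_simps cos_add cos_diff sin_add sin_diff)
    have key0: "(\<integral>\<omega>. F Z J \<omega> * indicator (S j) (Z j \<omega>) \<partial>Q) = (\<integral>\<omega>. F Z' J \<omega> * indicator (S j) (Z' j \<omega>) \<partial>Q)"
    proof (rule weighted_char_determines_integral)
      show "(\<integral>\<omega>. F Z J \<omega> * cos (l * Z j \<omega> + \<theta>) \<partial>Q) = (\<integral>\<omega>. F Z' J \<omega> * cos (l * Z' j \<omega> + \<theta>) \<partial>Q)" for l \<theta>
        unfolding L1 by (rule insert.IH[OF J])
    qed (use F01 intF in auto)
    have nonneg: "0 \<le> F Y J \<omega> * (1 + cos (L a Y \<omega> + \<theta>))" for a \<theta> Y \<omega>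
      using cos_ge_minus_one[of "L a Y \<omega> + \<theta>"] by (intro mult_nonneg_nonneg F01) linarith
    have key: "(\<integral>\<omega>. F Z J \<omega> * (1 + cos (L a Z \<omega> + \<theta>)) * indicator (S j) (Z j \<omega>) \<partial>Q) =
        (\<integral>\<omega>. F Z' J \<omega> * (1 + cos (L a Z' \<omega> + \<theta>)) * indicator (S j) (Z' j \<omega>) \<partial>Q)" for a \<theta>
    proof (rule weighted_char_determines_integral)
      show "(\<integral>\<omega>. F Z J \<omega> * (1 + cos (L a Z \<omega> + \<theta>)) * cos (l * Z j \<omega> + \<eta>) \<partial>Q) =
          (\<integral>\<omega>. F Z' J \<omega> * (1 + cos (L a Z' \<omega> + \<theta>)) * cos (l * Z' j \<omega> + \<eta>) \<partial>Q)" for l \<eta>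
        unfolding split by (simp add: int insert.IH[OF J])
      show "integrable Q (\<lambda>\<omega>. F Z J \<omega> * (1 + cos (L a Z \<omega> + \<theta>)))"
           "integrable Q (\<lambda>\<omega>. F Z' J \<omega> * (1 + cos (L a Z' \<omega> + \<theta>)))"
        using intF int by (auto simp: distrib_left)
    qed (use j nonneg in simp_all)
    have "F Y (insert j J) \<omega> * cos (L a Y \<omega> + \<theta>) =
        F Y J \<omega> * (1 + cos (L a Y \<omega> + \<theta>)) * indicator (S j) (Y j \<omega>) - F Y J \<omega> * indicator (S j) (Y j \<omega>)"
      for Y \<omega> using insert.hyps by (simp add: F_def algebra_simps)
    moreover have "integrable Q (\<lambda>\<omega>. F Z J \<omega> * (1 + cos (L a Z \<omega> + \<theta>)) * indicator (S j) (Z j \<omega>))"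
       "integrable Q (\<lambda>\<omega>. F Z' J \<omega> * (1 + cos (L a Z' \<omega> + \<theta>)) * indicator (S j) (Z' j \<omega>))"
      using intS by (auto simp: distrib_left distrib_right)
    ultimately show ?case
      using intS key key0 by simp
  qed
  from this[of K "\<lambda>_. 0" 0] have "(\<integral>\<omega>. F Z K \<omega> \<partial>Q) = (\<integral>\<omega>. F Z' K \<omega> \<partial>Q)"
    by (simp add: L_def)
  moreover have "(\<integral>\<omega>. F Y K \<omega> \<partial>Q) = measure Q {\<omega> \<in> space Q. \<forall>k\<in>K. Y k \<omega> \<in> S k}" for Y
  proof -
    have "(\<integral>\<omega>. F Y K \<omega> \<partial>Q) = (\<integral>\<omega>. indicator {\<omega> \<in> space Q. \<forall>k\<in>K. Y k \<omega> \<in> S k} \<omega> \<partial>Q)"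
      using fin by (intro Bochner_Integration.integral_cong)
        (auto simp: F_def indicator_def prod_zero_iff)
    then show ?thesis by (simp add: Int_absorb1 Int_commute subset_eq)
  qed
  ultimately show ?thesis by simp
qed

section \<open>Gaussian families and the theorem of Fernique\<close>

text \<open>The characteristic function at 1, in real form: taking \<theta> to be 0 and a quarter period gives
its two parts. Stated for all multiples of Z, this says that Z is normal with mean zero,
a point mass at zero being included.\<close>

definition centred_gaussian :: "'w measure \<Rightarrow> ('w \<Rightarrow> real) \<Rightarrow> bool"
  where "centred_gaussian P Z \<longleftrightarrow> Z \<in> borel_measurable P \<and> integrable P (\<lambda>\<omega>. (Z \<omega>)\<^sup>2) \<and>
    (\<forall>\<theta>. (\<integral>\<omega>. cos (Z \<omega> + \<theta>) \<partial>P) = exp (- (\<integral>\<omega>. (Z \<omega>)\<^sup>2 \<partial>P) / 2) * cos \<theta>)"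

lemma std_normal_cosine:
  "(\<integral>x. cos (s * x + \<theta>) \<partial>std_normal_distribution) = exp (- s\<^sup>2 / 2) * cos \<theta>"
proof -
  interpret real_distribution std_normal_distribution
    by (rule real_dist_normal_dist)
  have c: "(\<integral>x. iexp (s * x) \<partial>std_normal_distribution) = complex_of_real (exp (- s\<^sup>2 / 2))"
    using fun_cong[OF char_std_normal_distribution, of s] by (simp add: char_def)
  have i: "integrable std_normal_distribution (\<lambda>x. iexp (s * x))"
    by (rule integrable_const_bound[where B = 1]) auto
  have 1: "(\<integral>x. cos (s * x) \<partial>std_normal_distribution) = exp (- s\<^sup>2 / 2)"
    using arg_cong[OF c, of Re] i by (simp flip: integral_Re add: Re_exp)
  have 2: "(\<integral>x. sin (s * x) \<partial>std_normal_distribution) = 0"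
    using arg_cong[OF c, of Im] i by (simp flip: integral_Im add: Im_exp)
  have "integrable std_normal_distribution (\<lambda>x. cos (s * x))" "integrable std_normal_distribution (\<lambda>x. sin (s * x))"
    by (rule integrable_const_bound[where B = 1]; auto)+
  then show ?thesis by (simp add: cos_add 1 2)
qed

lemma gaussian_law_centred:
  assumes "prob_space P" and [measurable]: "Z \<in> borel_measurable P"
    and g: "gaussian (distr P borel Z)"
  shows "integrable P Z" and "centred_gaussian P (\<lambda>\<omega>. Z \<omega> - (\<integral>\<omega>. Z \<omega> \<partial>P))"
proof -
  interpret prob_space P by fact
  from g obtain \<mu> where "distr P borel Z = return borel \<mu> \<or>
      (\<exists>\<sigma>>0. distr P borel Z = density lborel (normal_density \<mu> \<sigma>))"
    unfolding gaussian_def by blast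
  then have "integrable P Z \<and> centred_gaussian P (\<lambda>\<omega>. Z \<omega> - (\<integral>\<omega>. Z \<omega> \<partial>P))"
  proof (elim disjE exE conjE)
    assume *: "distr P borel Z = return borel \<mu>"
    have "AE x in distr P borel Z. x = \<mu>"
      unfolding * by (subst AE_return) auto
    then have Z: "AE \<omega> in P. Z \<omega> = \<mu>"
      by (subst (asm) AE_distr_iff) auto
    have i: "integrable P Z"
      by (rule integrable_const_bound[where B = "\<bar>\<mu>\<bar>"]) (use Z in auto)
    have E: "(\<integral>\<omega>. Z \<omega> \<partial>P) = \<mu>"
      using integral_cong_AE[of Z P "\<lambda>_. \<mu>"] Z by (simp add: prob_space)
    have Z0: "AE \<omega> in P. Z \<omega> - \<mu> = 0" using Z by auto
    have "(\<integral>\<omega>. (Z \<omega> - \<mu>)\<^sup>2 \<partial>P) = 0"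
      using integral_cong_AE[of "\<lambda>\<omega>. (Z \<omega> - \<mu>)\<^sup>2" P "\<lambda>_. 0"] Z0 by auto
    moreover have "(\<integral>\<omega>. cos (Z \<omega> - \<mu> + \<theta>) \<partial>P) = cos \<theta>" for \<theta>
    proof -
      have "AE \<omega> in P. cos (Z \<omega> - \<mu> + \<theta>) = cos \<theta>" using Z by eventually_elim simp
      then have "(\<integral>\<omega>. cos (Z \<omega> - \<mu> + \<theta>) \<partial>P) = (\<integral>\<omega>. cos \<theta> \<partial>P)"
        by (intro integral_cong_AE) auto
      then show ?thesis by (simp add: prob_space)
    qed
    moreover have "integrable P (\<lambda>\<omega>. (Z \<omega> - \<mu>)\<^sup>2)"
      by (rule integrable_const_bound[where B = 0]) (use Z0 in auto)
    ultimately show ?thesis using i unfolding E centred_gaussian_def by simp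
  next
    fix \<sigma> :: real
    assume s: "\<sigma> > 0" and *: "distr P borel Z = density lborel (normal_density \<mu> \<sigma>)"
    have d: "distributed P lborel Z (normal_density \<mu> \<sigma>)"
      using * by (auto simp: distributed_def cong: distr_cong)
    define Y where "Y \<omega> = (Z \<omega> - \<mu>) / \<sigma>" for \<omega>
    have [measurable]: "Y \<in> borel_measurable P" unfolding Y_def by measurable
    have "distributed P lborel Y std_normal_density"
      unfolding Y_def using d normal_standard_normal_convert[OF s] by blast
    then have Y: "distr P borel Y = std_normal_distribution"
      by (auto simp: distributed_def cong: distr_cong)
    have Zeq: "Z \<omega> = \<mu> + \<sigma> * Y \<omega>" for \<omega> using s by (simp add: Y_def)
    have D: "integrable std_normal_distribution f \<longleftrightarrow> integrable P (\<lambda>\<omega>. f (Y \<omega>))"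
        "(\<integral>x. f x \<partial>std_normal_distribution) = (\<integral>\<omega>. f (Y \<omega>) \<partial>P)"
      if "f \<in> borel_measurable borel" for f :: "real \<Rightarrow> real"
      unfolding Y[symmetric] using that by (auto simp: integrable_distr_eq integral_distr)
    have pw: "(\<lambda>x::real. x ^ k) \<in> borel_measurable borel" for k by measurable
    have "integrable P (\<lambda>\<omega>. Y \<omega> ^ 1)"
      by (rule D(1)[OF pw, THEN iffD1]) (rule integrable_std_normal_distribution_moment)
    then have m1: "integrable P Y" by (simp only: power_one_right)
    have "(\<integral>\<omega>. Y \<omega> ^ 1 \<partial>P) = 0"
      by (rule trans[OF D(2)[OF pw, symmetric] integral_std_normal_distribution_moment_odd]) (rule odd_one)
    then have m1': "(\<integral>\<omega>. Y \<omega> \<partial>P) = 0" by (simp only: power_one_right)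
    have m2: "integrable P (\<lambda>\<omega>. (Y \<omega>)\<^sup>2)"
      by (rule D(1)[OF pw, THEN iffD1]) (rule integrable_std_normal_distribution_moment)
    have "(\<integral>\<omega>. Y \<omega> ^ (2 * 1) \<partial>P) = 1"
      by (rule trans[OF D(2)[OF pw, symmetric] trans[OF std_normal_distribution_even_moments(1)]]) simp
    then have m2': "(\<integral>\<omega>. (Y \<omega>)\<^sup>2 \<partial>P) = 1" by (simp only: mult_1_right)
    have c: "(\<integral>\<omega>. cos (\<sigma> * Y \<omega> + \<theta>) \<partial>P) = exp (- \<sigma>\<^sup>2 / 2) * cos \<theta>" for \<theta>
      by (rule trans[OF D(2)[symmetric] std_normal_cosine]) measurable
    have E: "(\<integral>\<omega>. Z \<omega> \<partial>P) = \<mu>" unfolding Zeq using m1 m1' by (simp add: prob_space)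
    show ?thesis
      unfolding E centred_gaussian_def unfolding Zeq using m1 m2 m2' c by (simp add: power_mult_distrib)
  qed
  then show "integrable P Z" and "centred_gaussian P (\<lambda>\<omega>. Z \<omega> - (\<integral>\<omega>. Z \<omega> \<partial>P))" by auto
qed

text \<open>The points p k may repeat, which is why the sum is regrouped by its distinct points before the
finite-dimensional law is used.\<close>

lemma gaussian_process_combination:
  fixes V :: "'i \<Rightarrow> 'w \<Rightarrow> real"
  assumes P: "prob_space P" and V: "gaussian_process P V" and K: "finite K"
  shows "centred_gaussian P (\<lambda>\<omega>. \<Sum>k\<in>K. a k * (V (p k) \<omega> - mean_fun P V (p k)))"
proof -
  interpret prob_space P by fact
  have [measurable]: "V i \<in> borel_measurable P" for i using V by (simp add: gaussian_process_def)
  have law: "gaussian (distr P borel (\<lambda>\<omega>. \<Sum>i\<in>I. c i * V i \<omega>))" if "finite I" for I c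
  proof -
    have "gaussian (distr (distr P (Pi\<^sub>M I (\<lambda>_. borel)) (\<lambda>\<omega>. \<lambda>i\<in>I. V i \<omega>)) borel (\<lambda>v. \<Sum>i\<in>I. c i * v i))"
      using V that by (auto simp: gaussian_process_def multivariate_gaussian_def)
    also have "distr (distr P (Pi\<^sub>M I (\<lambda>_. borel)) (\<lambda>\<omega>. \<lambda>i\<in>I. V i \<omega>)) borel (\<lambda>v. \<Sum>i\<in>I. c i * v i)
        = distr P borel (\<lambda>\<omega>. \<Sum>i\<in>I. c i * V i \<omega>)"
      by (subst distr_distr) (auto simp: comp_def intro!: distr_cong measurable_restrict)
    finally show ?thesis .
  qed
  have int: "integrable P (V i)" for i
    using gaussian_law_centred(1)[OF P, of "V i"] law[of "{i}" "\<lambda>_. 1"] by simp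
  define c where "c q = (\<Sum>k\<in>{k\<in>K. p k = q}. a k)" for q
  have group: "(\<Sum>k\<in>K. a k * f (p k)) = (\<Sum>q\<in>p ` K. c q * f q)" for f :: "'i \<Rightarrow> real"
    using sum.image_gen[OF K, of "\<lambda>k. a k * f (p k)" p] by (simp add: c_def sum_distrib_right)
  have "centred_gaussian P (\<lambda>\<omega>. (\<Sum>q\<in>p ` K. c q * V q \<omega>) - (\<integral>\<omega>. (\<Sum>q\<in>p ` K. c q * V q \<omega>) \<partial>P))"
    by (intro gaussian_law_centred P law) (use K in auto)
  also have "(\<lambda>\<omega>. (\<Sum>q\<in>p ` K. c q * V q \<omega>) - (\<integral>\<omega>. (\<Sum>q\<in>p ` K. c q * V q \<omega>) \<partial>P)) =
      (\<lambda>\<omega>. \<Sum>k\<in>K. a k * (V (p k) \<omega> - mean_fun P V (p k)))"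
    using int by (subst group[of "\<lambda>q. V q _ - mean_fun P V q"])
      (simp add: mean_fun_def right_diff_distrib sum_subtractf)
  finally show ?thesis .
qed

text \<open>Rotation invariance of the law of two independent copies. The characteristic function of a linear
combination of both copies depends only on the sum of two variances, and the variance is a quadratic
form, so that the parallelogram identity shows it to be unchanged by the rotation by 45 degrees.\<close>

lemma rotated_pair_rectangle:
  fixes X :: "'i \<Rightarrow> 'w \<Rightarrow> real"
  assumes P: "prob_space P" and I: "finite I"
    and X: "\<And>a. centred_gaussian P (\<lambda>\<omega>. \<Sum>i\<in>I. a i * X i \<omega>)"
    and Xm: "\<And>i. i \<in> I \<Longrightarrow> X i \<in> borel_measurable P"
    and S: "S \<in> sets borel" and S': "S' \<in> sets borel"
  shows "measure (P \<Otimes>\<^sub>M P) {(\<omega>, \<omega>') \<in> space (P \<Otimes>\<^sub>M P). \<forall>i\<in>I. X i \<omega> \<in> S \<and> X i \<omega>' \<in> S'} =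
         measure (P \<Otimes>\<^sub>M P) {(\<omega>, \<omega>') \<in> space (P \<Otimes>\<^sub>M P).
            \<forall>i\<in>I. (X i \<omega> + X i \<omega>') / sqrt 2 \<in> S \<and> (X i \<omega> - X i \<omega>') / sqrt 2 \<in> S'}"
proof -
  interpret prob_space P by fact
  interpret PP: pair_prob_space P P by unfold_locales
  note [measurable] = Xm
  define L where "L a \<omega> = (\<Sum>i\<in>I. a i * X i \<omega>)" for a \<omega>
  define v where "v a = (\<integral>\<omega>. (L a \<omega>)\<^sup>2 \<partial>P)" for a
  have [measurable]: "L a \<in> borel_measurable P" and L2: "integrable P (\<lambda>\<omega>. (L a \<omega>)\<^sup>2)"
    and Lc: "(\<integral>\<omega>. cos (L a \<omega> + \<theta>) \<partial>P) = exp (- v a / 2) * cos \<theta>" for a \<theta>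
    using X[of a] by (auto simp: centred_gaussian_def L_def[abs_def] v_def)
  have joint: "(\<integral>z. cos (L a (fst z) + L b (snd z) + \<theta>) \<partial>(P \<Otimes>\<^sub>M P)) = exp (- (v a + v b) / 2) * cos \<theta>" for a b \<theta>
  proof -
    have "(\<integral>z. cos (L a (fst z) + L b (snd z) + \<theta>) \<partial>(P \<Otimes>\<^sub>M P)) =
        (\<integral>\<omega>. (\<integral>\<omega>'. cos (L b \<omega>' + (L a \<omega> + \<theta>)) \<partial>P) \<partial>P)"
      by (subst PP.integral_fst'[symmetric])
         (auto simp: algebra_simps intro!: PP.integrable_const_bound[where B = 1])
    also have "\<dots> = exp (- v b / 2) * (exp (- v a / 2) * cos \<theta>)"
      by (simp add: Lc)
    also have "\<dots> = exp (- (v a + v b) / 2) * cos \<theta>"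
    proof -
      have "exp (- (v a + v b) / 2) = exp (- v b / 2) * exp (- v a / 2)"
        by (subst exp_add[symmetric]) (simp add: field_simps)
      then show ?thesis by simp
    qed
    finally show ?thesis .
  qed
  have parallelogram: "v (\<lambda>i. (a i + b i) / sqrt 2) + v (\<lambda>i. (a i - b i) / sqrt 2) = v a + v b" for a b
  proof -
    have "(L (\<lambda>i. (a i + b i) / sqrt 2) \<omega>)\<^sup>2 + (L (\<lambda>i. (a i - b i) / sqrt 2) \<omega>)\<^sup>2 = (L a \<omega>)\<^sup>2 + (L b \<omega>)\<^sup>2" for \<omega>
    proof -
      have "L (\<lambda>i. (a i + b i) / sqrt 2) \<omega> = (L a \<omega> + L b \<omega>) / sqrt 2"
           "L (\<lambda>i. (a i - b i) / sqrt 2) \<omega> = (L a \<omega> - L b \<omega>) / sqrt 2"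
        by (simp_all add: L_def sum_divide_distrib flip: sum.distrib sum_subtractf add: field_simps)
      then show ?thesis by (simp only: power_divide) (simp add: power2_eq_square field_simps)
    qed
    then show ?thesis
      unfolding v_def using L2 by (simp flip: Bochner_Integration.integral_add)
  qed
  define Z where "Z k z = (case k of Inl i \<Rightarrow> X i (fst z) | Inr i \<Rightarrow> X i (snd z))"
    for k :: "'i + 'i" and z :: "'w \<times> 'w"
  define Z' where "Z' k z = (case k of Inl i \<Rightarrow> (X i (fst z) + X i (snd z)) / sqrt 2
      | Inr i \<Rightarrow> (X i (fst z) - X i (snd z)) / sqrt 2)"
    for k :: "'i + 'i" and z :: "'w \<times> 'w"
  define R where "R k = (case k of Inl _ \<Rightarrow> S | Inr _ \<Rightarrow> S')" for k :: "'i + 'i"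
  have "measure (P \<Otimes>\<^sub>M P) {z \<in> space (P \<Otimes>\<^sub>M P). \<forall>k\<in>I <+> I. Z k z \<in> R k} =
        measure (P \<Otimes>\<^sub>M P) {z \<in> space (P \<Otimes>\<^sub>M P). \<forall>k\<in>I <+> I. Z' k z \<in> R k}"
  proof (rule rectangles_determined_by_cosines)
    show "prob_space (P \<Otimes>\<^sub>M P)" by (rule PP.prob_space_axioms)
    fix a :: "'i + 'i \<Rightarrow> real" and \<theta>
    let ?a = "\<lambda>i. a (Inl i)" and ?b = "\<lambda>i. a (Inr i)"
    have "(\<Sum>k\<in>I <+> I. a k * Z k z) = L ?a (fst z) + L ?b (snd z)" for z
      using I by (simp add: sum.Plus L_def Z_def)
    moreover have "(\<Sum>k\<in>I <+> I. a k * Z' k z) =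
       L (\<lambda>i. (?a i + ?b i) / sqrt 2) (fst z) + L (\<lambda>i. (?a i - ?b i) / sqrt 2) (snd z)" for z
      using I by (simp add: sum.Plus L_def Z'_def flip: sum.distrib)
         (auto intro!: sum.cong simp: field_simps)
    ultimately show "(\<integral>z. cos ((\<Sum>k\<in>I <+> I. a k * Z k z) + \<theta>) \<partial>(P \<Otimes>\<^sub>M P)) =
        (\<integral>z. cos ((\<Sum>k\<in>I <+> I. a k * Z' k z) + \<theta>) \<partial>(P \<Otimes>\<^sub>M P))"
      by (simp add: joint parallelogram)
  qed (use I S S' in \<open>auto simp: Z_def Z'_def R_def\<close>)
  moreover have "{z \<in> space (P \<Otimes>\<^sub>M P). \<forall>k\<in>I <+> I. Z k z \<in> R k} =
      {(\<omega>, \<omega>') \<in> space (P \<Otimes>\<^sub>M P). \<forall>i\<in>I. X i \<omega> \<in> S \<and> X i \<omega>' \<in> S'}"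
    by (auto simp: Z_def R_def Plus_def ball_Un)
  moreover have "{z \<in> space (P \<Otimes>\<^sub>M P). \<forall>k\<in>I <+> I. Z' k z \<in> R k} =
      {(\<omega>, \<omega>') \<in> space (P \<Otimes>\<^sub>M P).
            \<forall>i\<in>I. (X i \<omega> + X i \<omega>') / sqrt 2 \<in> S \<and> (X i \<omega> - X i \<omega>') / sqrt 2 \<in> S'}"
    by (auto simp: Z'_def R_def Plus_def ball_Un)
  ultimately show ?thesis by simp
qed

text \<open>Let N be the maximum of the family and N' its independent copy. The left side is the probability that
N is at most s and N' exceeds t. After rotation this event forces both X and X' to be
large: if u is a component of the rotated sum with modulus at most s and w one of the rotated
difference with modulus above t, then (u + w) / sqrt 2 and (u - w) / sqrt 2 both exceed
(t - s) / sqrt 2 in modulus. Independence gives the square.\<close>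

lemma fernique_inequality_finite:
  fixes X :: "'i \<Rightarrow> 'w \<Rightarrow> real"
  assumes P: "prob_space P" and I: "finite I"
    and X: "\<And>a. centred_gaussian P (\<lambda>\<omega>. \<Sum>i\<in>I. a i * X i \<omega>)"
    and Xm: "\<And>i. i \<in> I \<Longrightarrow> X i \<in> borel_measurable P"
  defines "B u \<equiv> measure P {\<omega> \<in> space P. \<forall>i\<in>I. \<bar>X i \<omega>\<bar> \<le> u}"
  shows "B s * (1 - B t) \<le> (1 - B ((t - s) / sqrt 2))\<^sup>2"
proof -
  interpret prob_space P by fact
  interpret PP: pair_prob_space P P by unfold_locales
  note [measurable] = Xm
  define E where "E u = {\<omega> \<in> space P. \<forall>i\<in>I. \<bar>X i \<omega>\<bar> \<le> u}" for u
  have [measurable]: "E u \<in> sets P" for u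
    unfolding E_def using I by measurable
  have B: "B u = prob (E u)" for u by (simp add: B_def E_def)
  have times: "measure (P \<Otimes>\<^sub>M P) (A \<times> A') = prob A * prob A'" if "A \<in> sets P" "A' \<in> sets P" for A A'
    using that by (simp add: measure_def emeasure_pair_measure_Times enn2real_mult)
  define U where "U T = {(\<omega>, \<omega>') \<in> space (P \<Otimes>\<^sub>M P).
      \<forall>i\<in>I. (X i \<omega> + X i \<omega>') / sqrt 2 \<in> {-s..s} \<and> (X i \<omega> - X i \<omega>') / sqrt 2 \<in> T}" for T
  have Usets: "U T \<in> sets (P \<Otimes>\<^sub>M P)" if [measurable]: "T \<in> sets borel" for T
  proof -
    have "U T = {z \<in> space (P \<Otimes>\<^sub>M P). \<forall>i\<in>I. (X i (fst z) + X i (snd z)) / sqrt 2 \<in> {-s..s}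
        \<and> (X i (fst z) - X i (snd z)) / sqrt 2 \<in> T}"
      by (auto simp: U_def)
    also have "\<dots> \<in> sets (P \<Otimes>\<^sub>M P)" using I by measurable
    finally show ?thesis .
  qed
  have rot: "measure (P \<Otimes>\<^sub>M P) (U T) =
      measure (P \<Otimes>\<^sub>M P) {(\<omega>, \<omega>') \<in> space (P \<Otimes>\<^sub>M P). \<forall>i\<in>I. X i \<omega> \<in> {-s..s} \<and> X i \<omega>' \<in> T}"
    if "T \<in> sets borel" for T
    unfolding U_def by (rule rotated_pair_rectangle[OF P I X Xm, symmetric]) (use that in auto)
  have "{(\<omega>, \<omega>') \<in> space (P \<Otimes>\<^sub>M P). \<forall>i\<in>I. X i \<omega> \<in> {-s..s} \<and> X i \<omega>' \<in> {-t..t}} = E s \<times> E t"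
       "{(\<omega>, \<omega>') \<in> space (P \<Otimes>\<^sub>M P). \<forall>i\<in>I. X i \<omega> \<in> {-s..s} \<and> X i \<omega>' \<in> UNIV} = E s \<times> space P"
    by (auto simp: space_pair_measure E_def abs_le_iff minus_le_iff)
  then have meas: "measure (P \<Otimes>\<^sub>M P) (U {-t..t}) = B s * B t" "measure (P \<Otimes>\<^sub>M P) (U UNIV) = B s"
    using rot[of "{-t..t}"] rot[of UNIV] by (simp_all add: times B prob_space)
  have "U {-t..t} \<subseteq> U UNIV" by (auto simp: U_def)
  then have "B s * (1 - B t) = measure (P \<Otimes>\<^sub>M P) (U UNIV - U {-t..t})"
    using Usets by (subst PP.finite_measure_Diff) (auto simp: meas algebra_simps)
  also have "U UNIV - U {-t..t} \<subseteq> (space P - E ((t - s) / sqrt 2)) \<times> (space P - E ((t - s) / sqrt 2))"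
  proof
    fix z assume z: "z \<in> U UNIV - U {-t..t}"
    obtain \<omega> \<omega>' where zz: "z = (\<omega>, \<omega>')" by (cases z)
    have mem: "r \<in> {-u..u} \<longleftrightarrow> \<bar>r\<bar> \<le> u" for r u :: real by auto
    have sp: "\<omega> \<in> space P" "\<omega>' \<in> space P"
      and le: "\<forall>i\<in>I. \<bar>(X i \<omega> + X i \<omega>') / sqrt 2\<bar> \<le> s"
      and ex: "\<exists>i\<in>I. \<not> \<bar>(X i \<omega> - X i \<omega>') / sqrt 2\<bar> \<le> t"
      using z zz unfolding U_def mem by (auto simp: space_pair_measure)
    from ex obtain i where i: "i \<in> I" "\<bar>(X i \<omega> - X i \<omega>') / sqrt 2\<bar> > t"
      by (auto simp: not_le)
    with le have le: "\<bar>(X i \<omega> + X i \<omega>') / sqrt 2\<bar> \<le> s" by blast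
    define u w where "u = (X i \<omega> + X i \<omega>') / sqrt 2" and "w = (X i \<omega> - X i \<omega>') / sqrt 2"
    have X: "X i \<omega> = (u + w) / sqrt 2" "X i \<omega>' = (u - w) / sqrt 2"
      by (simp_all add: u_def w_def field_simps)
    have uw: "\<bar>u\<bar> \<le> s" "\<bar>w\<bar> > t" using i(2) le by (simp_all only: u_def w_def)
    then have "t - s < \<bar>u + w\<bar>" "t - s < \<bar>u - w\<bar>" by linarith+
    then have "(t - s) / sqrt 2 < \<bar>X i \<omega>\<bar>" "(t - s) / sqrt 2 < \<bar>X i \<omega>'\<bar>"
      unfolding X abs_divide by (simp_all add: divide_strict_right_mono)
    then show "z \<in> (space P - E ((t - s) / sqrt 2)) \<times> (space P - E ((t - s) / sqrt 2))"
      using i(1) sp by (auto simp: zz E_def not_le intro!: bexI[of _ i])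
  qed
  then have "measure (P \<Otimes>\<^sub>M P) (U UNIV - U {-t..t}) \<le>
      measure (P \<Otimes>\<^sub>M P) ((space P - E ((t - s) / sqrt 2)) \<times> (space P - E ((t - s) / sqrt 2)))"
    by (intro PP.finite_measure_mono) auto
  also have "\<dots> = (1 - B ((t - s) / sqrt 2))\<^sup>2"
    by (simp add: times prob_compl B power2_eq_square)
  finally show ?thesis .
qed

lemma fernique_inequality:
  fixes X :: "nat \<Rightarrow> 'w \<Rightarrow> real"
  assumes P: "prob_space P"
    and X: "\<And>I a. finite I \<Longrightarrow> centred_gaussian P (\<lambda>\<omega>. \<Sum>i\<in>I. a i * X i \<omega>)"
    and Xm: "\<And>i. X i \<in> borel_measurable P"
  defines "B u \<equiv> measure P {\<omega> \<in> space P. \<forall>i. \<bar>X i \<omega>\<bar> \<le> u}"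
  shows "B s * (1 - B t) \<le> (1 - B ((t - s) / sqrt 2))\<^sup>2"
proof -
  interpret prob_space P by fact
  note [measurable] = Xm
  define b where "b n u = prob {\<omega> \<in> space P. \<forall>i\<in>{..<n}. \<bar>X i \<omega>\<bar> \<le> u}" for n u
  have lim: "(\<lambda>n. b n u) \<longlonglongrightarrow> B u" for u
  proof -
    have "(\<lambda>n. b n u) \<longlonglongrightarrow> prob (\<Inter>n. {\<omega> \<in> space P. \<forall>i\<in>{..<n}. \<bar>X i \<omega>\<bar> \<le> u})"
      unfolding b_def by (rule finite_Lim_measure_decseq) (auto simp: decseq_def)
    also have "(\<Inter>n. {\<omega> \<in> space P. \<forall>i\<in>{..<n}. \<bar>X i \<omega>\<bar> \<le> u}) = {\<omega> \<in> space P. \<forall>i. \<bar>X i \<omega>\<bar> \<le> u}"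
      by auto
    finally show ?thesis by (simp add: B_def)
  qed
  show ?thesis
  proof (rule LIMSEQ_le)
    show "(\<lambda>n. b n s * (1 - b n t)) \<longlonglongrightarrow> B s * (1 - B t)"
      by (intro tendsto_intros lim)
    show "(\<lambda>n. (1 - b n ((t - s) / sqrt 2))\<^sup>2) \<longlonglongrightarrow> (1 - B ((t - s) / sqrt 2))\<^sup>2"
      by (intro tendsto_intros lim)
    show "\<exists>N. \<forall>n\<ge>N. b n s * (1 - b n t) \<le> (1 - b n ((t - s) / sqrt 2))\<^sup>2"
      unfolding b_def by (intro exI allI impI fernique_inequality_finite P X Xm) auto
  qed
qed

text \<open>The base 3/2 lies below the base 2 of the double exponent, so that the decay wins for every A.\<close>

lemma summable_double_exponential_decay:
  fixes A :: real
  shows "summable (\<lambda>n. exp (A * (3/2) ^ n) * (1/3) ^ (2 ^ n))"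
proof (rule summable_comparison_test_ev)
  have "(\<lambda>n. A * (3/4::real) ^ n) \<longlonglongrightarrow> A * 0"
    by (intro tendsto_mult tendsto_const LIMSEQ_realpow_zero) auto
  then have "eventually (\<lambda>n. A * (3/4) ^ n < 1/2) sequentially"
    by (rule order_tendstoD) auto
  then show "eventually (\<lambda>n. norm (exp (A * (3/2) ^ n) * (1/3) ^ (2 ^ n)) \<le> exp (-1/2) ^ n) sequentially"
  proof eventually_elim
    case (elim n)
    have "A * (3/2) ^ n = A * (3/4) ^ n * 2 ^ n"
      by (simp add: power_mult_distrib[symmetric] mult.assoc)
    also have "\<dots> \<le> 2 ^ n / 2" using mult_right_mono[OF less_imp_le[OF elim], of "2 ^ n"] by simp
    finally have 1: "exp (A * (3/2) ^ n) \<le> exp (2 ^ n / 2)" by simp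
    have "(1/3::real) \<le> exp (-1)"
      using exp_le by (simp add: exp_minus field_simps)
    then have "(1/3::real) ^ (2 ^ n) \<le> exp (-1) ^ (2 ^ n)" by (intro power_mono) auto
    also have "\<dots> = exp (- (2 ^ n))" by (simp flip: exp_of_nat_mult)
    finally have "exp (A * (3/2) ^ n) * (1/3) ^ (2 ^ n) \<le> exp (2 ^ n / 2) * exp (- (2 ^ n))"
      using 1 by (intro mult_mono) auto
    also have "\<dots> = exp (- (2 ^ n) / 2)" by (simp flip: exp_add)
    also have "\<dots> \<le> exp (- real n / 2)"
      using of_nat_mono[OF less_imp_le[OF less_exp[of n]], where 'a=real] by simp
    also have "\<dots> = exp (-1/2) ^ n" by (simp flip: exp_of_nat_mult)
    finally show ?case by simp
  qed
  show "summable (\<lambda>n. exp (-1/2::real) ^ n)" by (intro summable_geometric) simp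
qed

text \<open>Choose s such that the family is bounded by s with probability at least 3/4. Iterating
Fernique's inequality along thresholds growing like (3/2)^n squares the tail probability at each
step. The tails decay doubly exponentially while the thresholds grow only exponentially,
so the function that takes the value exp (c \<tau>(n)) on the event that the supremum lies between
consecutive thresholds has a finite integral; g dominates it.\<close>

theorem fernique_exponential_moment:
  fixes X :: "nat \<Rightarrow> 'w \<Rightarrow> real" and c :: real
  assumes P: "prob_space P"
    and X: "\<And>I a. finite I \<Longrightarrow> centred_gaussian P (\<lambda>\<omega>. \<Sum>i\<in>I. a i * X i \<omega>)"
    and bdd: "AE \<omega> in P. \<exists>K. \<forall>i. \<bar>X i \<omega>\<bar> \<le> K"
    and c: "c \<ge> 0"
  obtains g where "integrable P g" and "AE \<omega> in P. \<forall>i. exp (c * \<bar>X i \<omega>\<bar>) \<le> g \<omega>"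
proof -
  interpret prob_space P by fact
  have [measurable]: "X i \<in> borel_measurable P" for i
    using X[of "{i}" "\<lambda>_. 1"] by (simp add: centred_gaussian_def)
  define E where "E u = {\<omega> \<in> space P. \<forall>i. \<bar>X i \<omega>\<bar> \<le> u}" for u
  define B where "B u = prob (E u)" for u
  have [measurable]: "E u \<in> sets P" for u unfolding E_def by measurable
  have Emono: "E u \<subseteq> E v" if "u \<le> v" for u v using that by (auto simp: E_def intro: order_trans)
  have Bmono: "B u \<le> B v" if "u \<le> v" for u v
    unfolding B_def by (intro finite_measure_mono Emono that) auto
  have ineq: "B s * (1 - B t) \<le> (1 - B ((t - s) / sqrt 2))\<^sup>2" for s t
    unfolding B_def E_def by (rule fernique_inequality[OF P X]) auto
  have "(\<lambda>n. B (real n)) \<longlonglongrightarrow> prob (\<Union>n. E (real n))"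
    unfolding B_def by (rule finite_Lim_measure_incseq) (auto intro!: incseq_SucI Emono)
  moreover have "prob (\<Union>n. E (real n)) = 1"
  proof (subst prob_eq_1)
    show "AE \<omega> in P. \<omega> \<in> (\<Union>n. E (real n))"
      using bdd AE_space
    proof eventually_elim
      case (elim \<omega>)
      then obtain K where K: "\<forall>i. \<bar>X i \<omega>\<bar> \<le> K" by auto
      obtain n where "K \<le> real n" using real_arch_simple by blast
      then show ?case using K elim by (auto simp: E_def intro!: exI[of _ n] intro: order_trans)
    qed
  qed auto
  ultimately have "eventually (\<lambda>n. B (real n) > 3/4) sequentially"
    by (intro order_tendstoD(1)[where y = 1]) auto
  then obtain n0 where n0: "\<And>n. n \<ge> n0 \<Longrightarrow> B (real n) > 3/4" by (auto simp: eventually_sequentially)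
  define s where "s = real (max n0 1)"
  have s: "s \<ge> 1" "B s \<ge> 3/4" using n0[of "max n0 1"] by (auto simp: s_def)
  \<comment> \<open>the recursion needs a ratio above sqrt 2, summability one below 2; since sqrt 2 is at most 17/12,
      the factor 12 makes the difference between 3/2 and 17/12 absorb s\<close>
  define \<tau> where "\<tau> n = 12 * s * (3/2) ^ n" for n
  have sqrt2: "sqrt 2 \<le> 17/12" by (rule real_le_lsqrt) (auto simp: power2_eq_square)
  have step: "\<tau> n \<le> (\<tau> (Suc n) - s) / sqrt 2" for n
  proof -
    have "\<tau> n * sqrt 2 \<le> \<tau> n * (17/12)" using s sqrt2 by (intro mult_left_mono) (auto simp: \<tau>_def)
    also have "\<dots> = \<tau> (Suc n) - \<tau> n / 12" by (simp add: \<tau>_def)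
    also have "\<dots> \<le> \<tau> (Suc n) - s"
      using s mult_left_mono[of 1 "(3/2::real) ^ n" s] by (simp add: \<tau>_def)
    finally show ?thesis by (simp add: field_simps)
  qed
  have tail: "1 - B (\<tau> n) \<le> 3/4 * (1/3) ^ (2 ^ n)" for n
  proof (induction n)
    case 0
    have "B s \<le> B (\<tau> 0)" using s by (intro Bmono) (simp add: \<tau>_def)
    then show ?case using s by simp
  next
    case (Suc n)
    have "B (\<tau> n) \<le> 1" "B (\<tau> (Suc n)) \<le> 1" by (simp_all add: B_def)
    have "3/4 * (1 - B (\<tau> (Suc n))) \<le> B s * (1 - B (\<tau> (Suc n)))"
      using s \<open>B (\<tau> (Suc n)) \<le> 1\<close> by (intro mult_right_mono) auto
    also have "\<dots> \<le> (1 - B ((\<tau> (Suc n) - s) / sqrt 2))\<^sup>2" by (rule ineq)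
    also have "\<dots> \<le> (1 - B (\<tau> n))\<^sup>2"
      using Bmono[OF step[of n]] by (intro power_mono) (auto simp: B_def)
    also have "\<dots> \<le> (3/4 * (1/3) ^ (2 ^ n))\<^sup>2"
      using Suc \<open>B (\<tau> n) \<le> 1\<close> by (intro power_mono) auto
    also have "\<dots> = 9/16 * (1/3) ^ (2 ^ Suc n)"
      by (simp add: power_mult_distrib power_divide power_mult[symmetric] mult.commute)
    finally show ?case by simp
  qed
  define h where "h n \<omega> = exp (c * \<tau> (Suc n)) * indicator (space P - E (\<tau> n)) \<omega>" for n \<omega>
  define g where "g \<omega> = exp (c * \<tau> 0) + (\<Sum>n. h n \<omega>)" for \<omega>
  have h0: "h n \<omega> \<ge> 0" for n \<omega> by (simp add: h_def)
  have reach: "\<exists>m. \<forall>n\<ge>m. \<omega> \<in> E (\<tau> n)" if "\<omega> \<in> space P" "\<forall>i. \<bar>X i \<omega>\<bar> \<le> K" for \<omega> K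
  proof -
    obtain m where "K < (3/2::real) ^ m" using real_arch_pow[of "3/2"] by auto
    then have "K \<le> \<tau> n" if "n \<ge> m" for n
      using s power_increasing[OF that, of "3/2::real"] mult_mono[of 1 "12 * s" "(3/2::real)^m" "(3/2)^n"]
      by (simp add: \<tau>_def) 
    then show ?thesis using that unfolding E_def by (auto intro: order_trans)
  qed
  have summ: "summable (\<lambda>n. h n \<omega>)" if sp: "\<omega> \<in> space P" and le: "\<forall>i. \<bar>X i \<omega>\<bar> \<le> K" for \<omega> K
  proof -
    obtain m where m: "\<forall>n\<ge>m. \<omega> \<in> E (\<tau> n)" using reach[OF sp le] by blast
    show ?thesis
      by (rule summable_finite[of "{..<m}"]) (use m in \<open>auto simp: h_def not_less\<close>)
  qed
  have hint: "integrable P (h n)" for n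
    unfolding h_def by (intro integrable_mult_right integrable_real_indicator) (auto simp: emeasure_eq_measure)
  have hI: "(\<integral>\<omega>. norm (h n \<omega>) \<partial>P) = exp (c * \<tau> (Suc n)) * (1 - B (\<tau> n))" for n
    by (simp add: h_def B_def prob_compl Diff_Int_distrib2 measure_Diff abs_mult)
  have "summable (\<lambda>n. \<integral>\<omega>. norm (h n \<omega>) \<partial>P)"
  proof (rule summable_comparison_test)
    show "summable (\<lambda>n. 3/4 * (exp ((c * 18 * s) * (3/2) ^ n) * (1/3) ^ (2 ^ n)))"
      by (intro summable_mult summable_double_exponential_decay)
    have "norm (\<integral>\<omega>. norm (h n \<omega>) \<partial>P) \<le> 3/4 * (exp ((c * 18 * s) * (3/2) ^ n) * (1/3) ^ (2 ^ n))" for n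
    proof -
      have "norm (\<integral>\<omega>. norm (h n \<omega>) \<partial>P) = exp (c * \<tau> (Suc n)) * (1 - B (\<tau> n))"
        unfolding hI by (simp add: B_def)
      also have "\<dots> \<le> exp (c * \<tau> (Suc n)) * (3/4 * (1/3) ^ (2 ^ n))"
        by (intro mult_left_mono tail) auto
      also have "c * \<tau> (Suc n) = (c * 18 * s) * (3/2) ^ n" by (simp add: \<tau>_def)
      finally show ?thesis by (simp add: mult_ac)
    qed
    then show "\<exists>N. \<forall>n\<ge>N. norm (\<integral>\<omega>. norm (h n \<omega>) \<partial>P) \<le> 3/4 * (exp ((c * 18 * s) * (3/2) ^ n) * (1/3) ^ (2 ^ n))"
      by blast
  qed
  moreover have "AE \<omega> in P. summable (\<lambda>n. norm (h n \<omega>))"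
    using bdd AE_space by eventually_elim (use summ h0 in auto)
  ultimately have "integrable P g"
    unfolding g_def using hint by (intro Bochner_Integration.integrable_add integrable_const integrable_suminf) auto
  moreover have "AE \<omega> in P. \<forall>i. exp (c * \<bar>X i \<omega>\<bar>) \<le> g \<omega>"
    using bdd AE_space
  proof eventually_elim
    case (elim \<omega>)
    then obtain K where K: "\<forall>i. \<bar>X i \<omega>\<bar> \<le> K" by blast
    note sm = summ[OF elim(2) K]
    have "\<exists>m. \<omega> \<in> E (\<tau> m)" using reach[OF elim(2) K] by auto
    define m where "m = (LEAST m. \<omega> \<in> E (\<tau> m))"
    have m: "\<omega> \<in> E (\<tau> m)" unfolding m_def by (rule LeastI_ex) fact
    have "exp (c * \<tau> m) \<le> g \<omega>"
    proof (cases m)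
      case 0
      then show ?thesis using suminf_nonneg[OF sm h0] by (simp add: g_def)
    next
      case (Suc k)
      then have "k < (LEAST m. \<omega> \<in> E (\<tau> m))" by (simp add: m_def)
      then have "\<omega> \<notin> E (\<tau> k)" by (rule not_less_Least)
      then have "exp (c * \<tau> m) = h k \<omega>" using elim(2) Suc by (simp add: h_def)
      also have "\<dots> \<le> (\<Sum>n. h n \<omega>)"
        using sum_le_suminf[OF sm, of "{k}"] h0 by simp
      finally show ?thesis using exp_ge_zero[of "c * \<tau> 0"] unfolding g_def by linarith
    qed
    moreover have "exp (c * \<bar>X i \<omega>\<bar>) \<le> exp (c * \<tau> m)" for i
      using m c by (auto simp: E_def intro!: mult_left_mono)
    ultimately show ?case by (blast intro: order_trans)
  qed
  ultimately show thesis by (rule that)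
qed

section \<open>Functions of class C k and second differences\<close>

lemma C_k_mono: "C_k k f \<Longrightarrow> j \<le> k \<Longrightarrow> C_k j f"
  unfolding C_k_def by (meson le_trans order_less_le_trans)

lemma C_k_continuous:
  assumes "C_k k f"
  shows "\<lbrakk>1 \<le> k; b \<in> Basis\<rbrakk> \<Longrightarrow> continuous_on UNIV (partial_deriv b f)"
    and "\<lbrakk>2 \<le> k; b \<in> Basis; c \<in> Basis\<rbrakk> \<Longrightarrow> continuous_on UNIV (partial_deriv c (partial_deriv b f))"
proof -
  have *: "continuous_on UNIV (partials bs f)" if "set bs \<subseteq> Basis" "length bs \<le> k" for bs
    using assms that unfolding C_k_def by blast
  show "continuous_on UNIV (partial_deriv b f)" if "1 \<le> k" "b \<in> Basis"
    using *[of "[b]"] that by (simp add: partials_def)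
  show "continuous_on UNIV (partial_deriv c (partial_deriv b f))" if "2 \<le> k" "b \<in> Basis" "c \<in> Basis"
    using *[of "[c, b]"] that by (simp add: partials_def)
qed

lemma partial_deriv_along_line:
  assumes "\<And>x. (\<lambda>t. f (x + t *\<^sub>R b)) differentiable (at 0)"
  shows "((\<lambda>t. f (x + t *\<^sub>R b)) has_real_derivative partial_deriv b f (x + s *\<^sub>R b)) (at s within S)"
proof -
  have "((\<lambda>t. f ((x + s *\<^sub>R b) + t *\<^sub>R b)) has_real_derivative partial_deriv b f (x + s *\<^sub>R b)) (at 0)"
    using assms[of "x + s *\<^sub>R b"] unfolding partial_deriv_def
    by (auto simp: real_differentiable_def dest: DERIV_imp_deriv)
  moreover have "(x + s *\<^sub>R b) + t *\<^sub>R b = x + (t + s) *\<^sub>R b" for t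
    by (simp add: scaleR_add_left)
  ultimately have "((\<lambda>t. f (x + t *\<^sub>R b)) has_real_derivative partial_deriv b f (x + s *\<^sub>R b)) (at s)"
    using DERIV_shift[of "\<lambda>t. f (x + t *\<^sub>R b)" _ 0 s] by simp
  then show ?thesis by (rule has_field_derivative_at_within)
qed

lemma C_k_partial_along_line:
  assumes "C_k k f" and b: "b \<in> Basis"
  shows "1 \<le> k \<Longrightarrow> ((\<lambda>t. f (x + t *\<^sub>R b)) has_real_derivative partial_deriv b f (x + s *\<^sub>R b)) (at s within S)"
    and "\<lbrakk>2 \<le> k; c \<in> Basis\<rbrakk> \<Longrightarrow> ((\<lambda>t. partial_deriv c f (x + t *\<^sub>R b)) has_real_derivative
            partial_deriv b (partial_deriv c f) (x + s *\<^sub>R b)) (at s within S)"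
proof -
  have *: "(\<lambda>t. partials bs f (x + t *\<^sub>R b)) differentiable (at 0)" if "set bs \<subseteq> Basis" "length bs < k" for bs x
    using assms that unfolding C_k_def by blast
  show "1 \<le> k \<Longrightarrow> ((\<lambda>t. f (x + t *\<^sub>R b)) has_real_derivative partial_deriv b f (x + s *\<^sub>R b)) (at s within S)"
    using *[of "[]"] by (intro partial_deriv_along_line) (auto simp: partials_def)
  show "\<lbrakk>2 \<le> k; c \<in> Basis\<rbrakk> \<Longrightarrow> ((\<lambda>t. partial_deriv c f (x + t *\<^sub>R b)) has_real_derivative
            partial_deriv b (partial_deriv c f) (x + s *\<^sub>R b)) (at s within S)"
    using *[of "[c]"] by (intro partial_deriv_along_line) (auto simp: partials_def)
qed

lemma C_k_difference_quotient:
  assumes f: "C_k k f" and "1 \<le> k" and b: "b \<in> Basis"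
  shows "(\<lambda>n. real (Suc n) * (f (x + (1 / real (Suc n)) *\<^sub>R b) - f x)) \<longlonglongrightarrow> partial_deriv b f x"
proof -
  have "((\<lambda>t. f (x + t *\<^sub>R b)) has_real_derivative partial_deriv b f x) (at 0)"
    using C_k_partial_along_line(1)[OF f b, of x 0] \<open>1 \<le> k\<close> by simp
  then have "((\<lambda>t. (f (x + t *\<^sub>R b) - f x) / t) \<longlongrightarrow> partial_deriv b f x) (at 0)"
    by (simp add: has_field_derivative_iff)
  moreover have "filterlim (\<lambda>n. 1 / real (Suc n)) (at 0) sequentially"
    using LIMSEQ_inverse_real_of_nat by (auto simp: filterlim_at inverse_eq_divide)
  ultimately have "(\<lambda>n. (f (x + (1 / real (Suc n)) *\<^sub>R b) - f x) / (1 / real (Suc n))) \<longlonglongrightarrow> partial_deriv b f x"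
    by (rule filterlim_compose)
  then show ?thesis by (simp add: mult.commute)
qed

lemma mvt_bound_real:
  fixes g :: "real \<Rightarrow> real"
  assumes "\<And>t. (g has_real_derivative g' t) (at t)"
    and "\<And>t. min a b \<le> t \<Longrightarrow> t \<le> max a b \<Longrightarrow> \<bar>g' t\<bar> \<le> K"
  shows "\<bar>g b - g a\<bar> \<le> K * \<bar>b - a\<bar>"
proof (cases "a = b")
  case False
  have "\<bar>g (max a b) - g (min a b)\<bar> \<le> K * (max a b - min a b)"
  proof -
    have "min a b < max a b" using False by auto
    then obtain z where z: "z > min a b" "z < max a b"
      "g (max a b) - g (min a b) = (max a b - min a b) * g' z"
      using MVT2[of "min a b" "max a b" g g'] assms(1) by blast
    then show ?thesis using assms(2)[of z] False
      by (simp add: abs_mult mult.commute mult_left_mono)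
  qed
  then show ?thesis by (auto simp: max_def min_def abs_minus_commute split: if_splits)
qed auto

text \<open>The coordinates of z are replaced by those of y one at a time. The path stays in the cube, and the
mean value theorem applies on each of its segments, so only partial derivatives enter.\<close>

lemma lipschitz_from_partials:
  fixes f :: "'a::euclidean_space \<Rightarrow> real" and K :: real
  assumes der: "\<And>b x s. b \<in> Basis \<Longrightarrow> ((\<lambda>t. f (x + t *\<^sub>R b)) has_real_derivative f' b (x + s *\<^sub>R b)) (at s)"
    and bound: "\<And>b x. b \<in> Basis \<Longrightarrow> (\<forall>c\<in>Basis. \<bar>x \<bullet> c\<bar> \<le> \<rho>) \<Longrightarrow> \<bar>f' b x\<bar> \<le> K"
    and y: "\<forall>c\<in>Basis. \<bar>y \<bullet> c\<bar> \<le> \<rho>" and z: "\<forall>c\<in>Basis. \<bar>z \<bullet> c\<bar> \<le> \<rho>"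
  shows "\<bar>f y - f z\<bar> \<le> DIM('a) * K * norm (y - z)"
proof -
  define w where "w A = z + (\<Sum>b\<in>A. ((y - z) \<bullet> b) *\<^sub>R b)" for A
  have "K \<ge> 0"
    using bound[OF SOME_Basis y] by linarith
  have "\<bar>f (w A) - f z\<bar> \<le> (\<Sum>b\<in>A. K * \<bar>(y - z) \<bullet> b\<bar>)" if "A \<subseteq> Basis" for A
    using finite_subset[OF that finite_Basis] that
  proof (induction A rule: finite_induct)
    case (insert b A)
    then have b: "b \<in> Basis" and A: "A \<subseteq> Basis" "finite A" by auto
    have coord: "w A \<bullet> c = (if c \<in> A then y \<bullet> c else z \<bullet> c)" if c: "c \<in> Basis" for c
    proof -
      have "(\<Sum>b\<in>A. ((y - z) \<bullet> b) * (b \<bullet> c)) = (\<Sum>b\<in>A. if b = c then (y - z) \<bullet> c else 0)"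
        using A c by (intro sum.cong) (auto simp: inner_Basis)
      then show ?thesis
        using A c by (simp add: w_def inner_add_left inner_sum_left inner_diff_left)
    qed
    have ins: "w (insert b A) = w A + ((y - z) \<bullet> b) *\<^sub>R b"
      using insert by (simp add: w_def algebra_simps)
    have "\<bar>f (w A + ((y - z) \<bullet> b) *\<^sub>R b) - f (w A + 0 *\<^sub>R b)\<bar> \<le> K * \<bar>(y - z) \<bullet> b - 0\<bar>"
    proof (rule mvt_bound_real[where g = "\<lambda>t. f (w A + t *\<^sub>R b)"])
      show "((\<lambda>t. f (w A + t *\<^sub>R b)) has_real_derivative f' b (w A + t *\<^sub>R b)) (at t)" for t
        by (rule der[OF b])
      fix t assume t: "min 0 ((y - z) \<bullet> b) \<le> t" "t \<le> max 0 ((y - z) \<bullet> b)"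
      have "\<bar>(w A + t *\<^sub>R b) \<bullet> c\<bar> \<le> \<rho>" if c: "c \<in> Basis" for c
        using y[rule_format, OF c] z[rule_format, OF c] t insert.hyps c b coord[OF c]
        by (cases "c = b") (auto simp: inner_add_left inner_Basis inner_diff_left split: if_splits)
      then show "\<bar>f' b (w A + t *\<^sub>R b)\<bar> \<le> K" by (intro bound b) auto
    qed
    then have "\<bar>f (w (insert b A)) - f (w A)\<bar> \<le> K * \<bar>(y - z) \<bullet> b\<bar>" by (simp add: ins)
    then show ?case using insert A by auto
  qed (simp add: w_def)
  from this[of Basis] have "\<bar>f y - f z\<bar> \<le> (\<Sum>b\<in>Basis. K * \<bar>(y - z) \<bullet> b\<bar>)"
    by (simp add: w_def euclidean_representation)
  also have "\<dots> \<le> (\<Sum>b\<in>(Basis :: 'a set). K * norm (y - z))"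
    by (intro sum_mono mult_left_mono Basis_le_norm \<open>K \<ge> 0\<close>)
  finally show ?thesis by simp
qed

lemma continuous_bounded_on_cube:
  fixes f :: "'i \<Rightarrow> 'a::euclidean_space \<Rightarrow> real"
  assumes "finite I" and "\<And>i. i \<in> I \<Longrightarrow> continuous_on UNIV (f i)"
  obtains K :: real where "K \<ge> 0" and "\<And>i x. i \<in> I \<Longrightarrow> (\<forall>c\<in>Basis. \<bar>x \<bullet> c\<bar> \<le> \<rho>) \<Longrightarrow> \<bar>f i x\<bar> \<le> K"
proof -
  let ?B = "cbox (- \<rho> *\<^sub>R One) (\<rho> *\<^sub>R (One::'a))"
  have "\<exists>K. \<forall>x\<in>?B. \<bar>f i x\<bar> \<le> K" if "i \<in> I" for i
  proof -
    have "bounded (f i ` ?B)"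
      by (intro compact_imp_bounded compact_continuous_image continuous_on_subset[OF assms(2)] that) auto
    then show ?thesis by (auto simp: bounded_real)
  qed
  then obtain K where K: "\<And>i x. i \<in> I \<Longrightarrow> x \<in> ?B \<Longrightarrow> \<bar>f i x\<bar> \<le> K i" by metis
  have B: "x \<in> ?B" if "\<forall>c\<in>Basis. \<bar>x \<bullet> c\<bar> \<le> \<rho>" for x
    using that by (auto simp: mem_box abs_le_iff minus_le_iff)
  show thesis
  proof
    show "0 \<le> (\<Sum>i\<in>I. \<bar>K i\<bar>)" by (simp add: sum_nonneg)
    fix i and x :: 'a assume "i \<in> I" and x: "\<forall>c\<in>Basis. \<bar>x \<bullet> c\<bar> \<le> \<rho>"
    then have "\<bar>f i x\<bar> \<le> \<bar>K i\<bar>" using K[OF \<open>i \<in> I\<close> B[OF x]] by linarith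
    also have "\<dots> \<le> (\<Sum>i\<in>I. \<bar>K i\<bar>)"
      using assms(1) \<open>i \<in> I\<close> by (intro member_le_sum) auto
    finally show "\<bar>f i x\<bar> \<le> (\<Sum>i\<in>I. \<bar>K i\<bar>)" .
  qed
qed

text \<open>The increments of f in direction b with step 1 / (n + 1), taken at y and z, are compared relative to the step and the
distance. As n grows, the value tends to the difference quotient of the partial derivative in
direction b. For y = z the value is 0 by division by zero.\<close>

definition second_difference :: "('a::euclidean_space \<Rightarrow> real) \<Rightarrow> 'a \<times> 'a \<times> 'a \<times> nat \<Rightarrow> real"
  where "second_difference f = (\<lambda>(y, z, b, n).
    real (Suc n) / norm (y - z) *
      ((f (y + (1 / real (Suc n)) *\<^sub>R b) - f y) - (f (z + (1 / real (Suc n)) *\<^sub>R b) - f z)))"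

text \<open>By the mean value theorem the increment of f with step h has partial derivatives of size h times a second
partial derivative, and it is therefore Lipschitz with a constant proportional to h.
The step is at most 1, so the unit neighbourhood of the cube suffices.\<close>

lemma second_difference_bounded:
  fixes f :: "'a::euclidean_space \<Rightarrow> real"
  assumes f: "C_k 2 f"
  obtains K where "\<And>y z b n. \<lbrakk>norm y \<le> \<rho>; norm z \<le> \<rho>; b \<in> Basis\<rbrakk> \<Longrightarrow> \<bar>second_difference f (y, z, b, n)\<bar> \<le> K"
proof -
  obtain K :: real where K0: "K \<ge> 0" and K: "\<And>i x. i \<in> Basis \<times> Basis \<Longrightarrow> (\<forall>c\<in>Basis. \<bar>x \<bullet> c\<bar> \<le> \<rho> + 1) \<Longrightarrow>
      \<bar>partial_deriv (snd i) (partial_deriv (fst i) f) x\<bar> \<le> K"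
    by (rule continuous_bounded_on_cube[of "Basis \<times> Basis" "\<lambda>i. partial_deriv (snd i) (partial_deriv (fst i) f)" "\<rho> + 1"])
       (use C_k_continuous(2)[OF f] in auto)
  have main: "\<bar>second_difference f (y, z, b, n)\<bar> \<le> DIM('a) * K"
    if y: "norm y \<le> \<rho>" and z: "norm z \<le> \<rho>" and b: "b \<in> Basis" for y z b n
  proof (cases "y = z")
    case False
    define h where "h = 1 / real (Suc n)"
    have h: "0 < h" "h \<le> 1" by (auto simp: h_def)
    define g where "g x = f (x + h *\<^sub>R b) - f x" for x
    define g' where "g' c x = partial_deriv c f (x + h *\<^sub>R b) - partial_deriv c f x" for c x
    have "\<bar>g y - g z\<bar> \<le> DIM('a) * (K * h) * norm (y - z)"
    proof (rule lipschitz_from_partials[where f = g and f' = g'])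
      fix c :: 'a and x s assume c: "c \<in> Basis"
      have "((\<lambda>t. f ((x + h *\<^sub>R b) + t *\<^sub>R c) - f (x + t *\<^sub>R c)) has_real_derivative
          (partial_deriv c f ((x + h *\<^sub>R b) + s *\<^sub>R c) - partial_deriv c f (x + s *\<^sub>R c))) (at s)"
        by (intro DERIV_diff C_k_partial_along_line(1)[OF f c]) auto
      then show "((\<lambda>t. g (x + t *\<^sub>R c)) has_real_derivative g' c (x + s *\<^sub>R c)) (at s)"
        by (simp add: g_def g'_def algebra_simps)
    next
      fix c x :: 'a assume c: "c \<in> Basis" and x: "\<forall>c\<in>Basis. \<bar>x \<bullet> c\<bar> \<le> \<rho>"
      have "\<bar>partial_deriv c f (x + h *\<^sub>R b) - partial_deriv c f (x + 0 *\<^sub>R b)\<bar> \<le> K * \<bar>h - 0\<bar>"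
      proof (rule mvt_bound_real[where g = "\<lambda>t. partial_deriv c f (x + t *\<^sub>R b)"])
        show "((\<lambda>t. partial_deriv c f (x + t *\<^sub>R b)) has_real_derivative
            partial_deriv b (partial_deriv c f) (x + t *\<^sub>R b)) (at t)" for t
          by (intro C_k_partial_along_line(2)[OF f b]) (use c in auto)
        fix t assume t: "min 0 h \<le> t" "t \<le> max 0 h"
        have "\<bar>(x + t *\<^sub>R b) \<bullet> d\<bar> \<le> \<rho> + 1" if d: "d \<in> Basis" for d
          using x[rule_format, OF d] t h b d by (auto simp: inner_add_left inner_Basis)
        then show "\<bar>partial_deriv b (partial_deriv c f) (x + t *\<^sub>R b)\<bar> \<le> K"
          using K[of "(c, b)"] b c by auto
      qed
      then show "\<bar>g' c x\<bar> \<le> K * h" using h by (simp add: g'_def)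
    qed (use y z Basis_le_norm order_trans in blast)+
    moreover have "second_difference f (y, z, b, n) = (g y - g z) / (h * norm (y - z))"
      by (simp add: second_difference_def g_def h_def)
    ultimately show ?thesis
      using h False by (simp add: divide_le_eq mult_ac)
  qed (use K0 in \<open>simp add: second_difference_def\<close>)
  show thesis by (rule that[OF main])
qed

text \<open>Countably many second differences suffice: the estimate is obtained for points of the dense set by
letting the step tend to 0, and both of its sides are continuous.\<close>

lemma partial_deriv_lipschitz_from_second_difference:
  fixes f :: "'a::euclidean_space \<Rightarrow> real"
  assumes f: "C_k 2 f" and D: "closure D = UNIV" and b: "b \<in> Basis" and "L \<ge> 0"
    and L: "\<And>y z n. \<lbrakk>y \<in> D; z \<in> D; norm y < r; norm z < r\<rbrakk> \<Longrightarrow> \<bar>second_difference f (y, z, b, n)\<bar> \<le> L"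
    and y: "norm y < r" and z: "norm z < r"
  shows "\<bar>partial_deriv b f y - partial_deriv b f z\<bar> \<le> L * norm (y - z)"
proof -
  note quot = C_k_difference_quotient[OF f _ b]
  have dense: "\<bar>partial_deriv b f y - partial_deriv b f z\<bar> \<le> L * norm (y - z)"
    if "y \<in> D" "z \<in> D" "norm y < r" "norm z < r" for y z
  proof (cases "y = z")
    case False
    have "(\<lambda>n. \<bar>real (Suc n) * (f (y + (1 / real (Suc n)) *\<^sub>R b) - f y)
            - real (Suc n) * (f (z + (1 / real (Suc n)) *\<^sub>R b) - f z)\<bar>)
          \<longlonglongrightarrow> \<bar>partial_deriv b f y - partial_deriv b f z\<bar>"
      by (intro tendsto_rabs tendsto_diff quot) auto
    moreover have "\<bar>real (Suc n) * (f (y + (1 / real (Suc n)) *\<^sub>R b) - f y)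
            - real (Suc n) * (f (z + (1 / real (Suc n)) *\<^sub>R b) - f z)\<bar> \<le> L * norm (y - z)" for n
    proof -
      have "real (Suc n) * (f (y + (1 / real (Suc n)) *\<^sub>R b) - f y)
            - real (Suc n) * (f (z + (1 / real (Suc n)) *\<^sub>R b) - f z) = second_difference f (y, z, b, n) * norm (y - z)"
        using False by (simp add: second_difference_def field_simps del: of_nat_Suc)
      then show ?thesis using L[OF that, of n] by (simp add: abs_mult mult_right_mono)
    qed
    ultimately show ?thesis by (intro LIMSEQ_le_const2) auto
  qed auto
  define E where "E = {p. \<bar>partial_deriv b f (fst p) - partial_deriv b f (snd p)\<bar> \<le> L * norm (fst p - snd p)}"
  have c: "continuous_on UNIV (partial_deriv b f)" using C_k_continuous(1)[OF f] b by auto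
  have "closed E"
    unfolding E_def
    by (intro closed_Collect_le continuous_intros continuous_on_compose2[OF c]) auto
  have "(D \<inter> ball 0 r) \<times> (D \<inter> ball 0 r) \<subseteq> E" using dense by (auto simp: E_def)
  then have "closure (D \<inter> ball 0 r) \<times> closure (D \<inter> ball 0 r) \<subseteq> E"
    using closure_minimal[OF _ \<open>closed E\<close>] by (metis closure_Times)
  moreover have "ball 0 r \<subseteq> closure (D \<inter> ball 0 r)"
    using open_Int_closure_subset[of "ball 0 r" D] D by (simp add: Int_commute)
  ultimately have "(y, z) \<in> E" using y z by (auto simp: subset_iff)
  then show ?thesis by (simp add: E_def)
qed

lemma norm_gradient_diff_le:
  fixes f :: "'a::euclidean_space \<Rightarrow> real" and K :: real
  assumes "\<And>b. b \<in> Basis \<Longrightarrow> \<bar>partial_deriv b f y - partial_deriv b f z\<bar> \<le> K"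
  shows "norm (gradient f y - gradient f z) \<le> DIM('a) * K"
proof -
  have "norm (gradient f y - gradient f z) = norm (\<Sum>b\<in>Basis. (partial_deriv b f y - partial_deriv b f z) *\<^sub>R b)"
    by (simp add: gradient_def scaleR_diff_left sum_subtractf)
  also have "\<dots> \<le> (\<Sum>b\<in>(Basis::'a set). K)"
    by (rule sum_norm_le) (use assms in auto)
  finally show ?thesis by simp
qed

lemma gradient_locally_lipschitz_bounded:
  fixes f :: "'a::euclidean_space \<Rightarrow> real"
  assumes f: "C_k 2 f"
  obtains L G where "\<And>y z. norm y \<le> \<rho> \<Longrightarrow> norm z \<le> \<rho> \<Longrightarrow> norm (gradient f y - gradient f z) \<le> L * norm (y - z)"
    and "\<And>y. norm y \<le> \<rho> \<Longrightarrow> norm (gradient f y) \<le> G"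
proof -
  obtain K where K: "\<And>y z b n. \<lbrakk>norm y \<le> \<rho> + 1; norm z \<le> \<rho> + 1; b \<in> Basis\<rbrakk> \<Longrightarrow> \<bar>second_difference f (y, z, b, n)\<bar> \<le> K"
    using second_difference_bounded[OF f] by blast
  have 1: "norm (gradient f y - gradient f z) \<le> DIM('a) * \<bar>K\<bar> * norm (y - z)" if y: "norm y \<le> \<rho>" and z: "norm z \<le> \<rho>" for y z
  proof -
    have "norm (gradient f y - gradient f z) \<le> DIM('a) * (\<bar>K\<bar> * norm (y - z))"
    proof (rule norm_gradient_diff_le)
      fix b :: 'a assume b: "b \<in> Basis"
      show "\<bar>partial_deriv b f y - partial_deriv b f z\<bar> \<le> \<bar>K\<bar> * norm (y - z)"
        by (rule partial_deriv_lipschitz_from_second_difference[OF f closure_UNIV b, where r = "\<rho> + 1"])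
           (use y z K b order_trans[OF K abs_ge_self] in auto)
    qed
    then show ?thesis by simp
  qed
  have "bounded (gradient f ` cball 0 \<rho>)"
    unfolding gradient_def[abs_def]
    by (intro compact_imp_bounded compact_continuous_image continuous_intros
         continuous_on_subset[OF C_k_continuous(1)[OF f]]) auto
  then obtain G where "\<forall>x\<in>cball 0 \<rho>. norm (gradient f x) \<le> G"
    by (auto simp: bounded_iff)
  with 1 show thesis by (intro that[of "DIM('a) * \<bar>K\<bar>" G]) auto
qed

section \<open>Pathwise error of the scheme\<close>

text \<open>A single constant H bounds all data, which keeps the final bound a function of one random
variable. Both the exact flow and the scheme are compared with an Euler step of length dt for the
Hamiltonian vector field F, whose Lipschitz constant on the ball is at most 2 H; their deviations are at
most 4 H^3 dt^2 and 9 H^4 dt^2. Hence the error e satisfies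
e (k + 1) \<le> (1 + 2 H dt) e k + 13 H^4 dt^2.\<close>

lemma leapfrog_error_bound:
  fixes M :: "real^'d^'d" and U :: "real^'d \<Rightarrow> real" and y x :: "real \<Rightarrow> real^'d"
  assumes sol: "hamiltonian_solution M U T z\<^sub>0 y x"
    and H: "H \<ge> 1"
    and inv: "\<And>v. norm (matrix_inv M *v v) \<le> H * norm v"
    and lip: "\<And>p q. \<lbrakk>norm p \<le> \<rho>; norm q \<le> \<rho>\<rbrakk> \<Longrightarrow> norm (gradient U p - gradient U q) \<le> H * norm (p - q)"
    and grad: "\<And>p. norm p \<le> \<rho> \<Longrightarrow> norm (gradient U p) \<le> H"
    and \<rho>: "\<rho> \<le> H"
    and exact: "\<And>t. t \<in> {0..T} \<Longrightarrow> norm (y t, x t) \<le> \<rho>"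
    and iter: "\<And>n. n \<le> N \<Longrightarrow> norm (leapfrog M U a b dt z\<^sub>0 n) \<le> \<rho>"
    and dt: "0 < dt" "dt \<le> 1" and NT: "real N * dt \<le> T"
    and a: "\<bar>a - 1\<bar> \<le> H * dt\<^sup>2" and b: "\<bar>b - 1\<bar> \<le> H * dt\<^sup>2"
    and n: "n \<le> N"
  shows "norm ((y (real n * dt), x (real n * dt)) - leapfrog M U a b dt z\<^sub>0 n)
           \<le> 13 * H ^ 4 * T * exp (2 * H * T) * dt"
proof -
  define A where "A v = matrix_inv M *v v" for v
  define F where "F z = (A (snd z), - gradient U (fst z))" for z :: "(real^'d) \<times> (real^'d)"
  define z where "z t = (y t, x t)" for t
  define w where "w = leapfrog M U a b dt z\<^sub>0"
  have Hp: "H > 0" "1 \<le> H\<^sup>2" "H \<le> H\<^sup>2" "H\<^sup>2 \<le> H ^ 3" "H ^ 3 \<le> H ^ 4" "1 \<le> H ^ 4"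
    using H power_increasing[of 1 2 H] power_increasing[of 2 3 H] power_increasing[of 3 4 H]
    by (auto intro: one_le_power)
  have A: "A (p - q) = A p - A q" "A (r *\<^sub>R p) = r *\<^sub>R A p" "norm (A p) \<le> H * norm p" for p q r
    using inv by (auto simp: A_def matrix_vector_mult_diff_distrib matrix_vector_mult_scaleR)
  have comp: "norm (fst p) \<le> \<rho>" "norm (snd p) \<le> \<rho>" if "norm p \<le> \<rho>" for p :: "(real^'d) \<times> (real^'d)"
    using that norm_fst_le[of "fst p" "snd p"] norm_snd_le[of "snd p" "fst p"] by auto
  have FLip: "norm (F p - F q) \<le> 2 * H * norm (p - q)" if "norm p \<le> \<rho>" "norm q \<le> \<rho>" for p q
  proof -
    have "norm (F p - F q) \<le> norm (A (snd p - snd q)) + norm (gradient U (fst q) - gradient U (fst p))"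
      unfolding F_def using norm_Pair_le by (auto simp: A)
    also have "\<dots> \<le> H * norm (snd p - snd q) + H * norm (fst q - fst p)"
      using A(3) lip comp that by (intro add_mono) auto
    also have "\<dots> \<le> H * norm (p - q) + H * norm (p - q)"
    proof (intro add_mono mult_left_mono)
      show "norm (snd p - snd q) \<le> norm (p - q)" by (metis snd_diff norm_snd_le prod.collapse)
      show "norm (fst q - fst p) \<le> norm (p - q)" by (metis fst_diff norm_fst_le norm_minus_commute prod.collapse)
    qed (use Hp in auto)
    finally show ?thesis by simp
  qed
  have Fb: "norm (F p) \<le> 2 * H\<^sup>2" if "norm p \<le> \<rho>" for p
  proof -
    have "norm (F p) \<le> norm (A (snd p)) + norm (gradient U (fst p))"
      unfolding F_def using norm_Pair_le[of "A (snd p)" "- gradient U (fst p)"] by simp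
    also have "\<dots> \<le> H * H + H"
    proof (rule add_mono[OF _ grad[OF comp(1)[OF that]]])
      have "H * norm (snd p) \<le> H * H" using comp(2)[OF that] \<rho> Hp by (intro mult_left_mono) auto
      then show "norm (A (snd p)) \<le> H * H" using A(3)[of "snd p"] by linarith
    qed
    also have "\<dots> \<le> 2 * H\<^sup>2" using Hp(3) unfolding power2_eq_square by linarith
    finally show ?thesis .
  qed
  have dz: "(z has_vector_derivative F (z t)) (at t within {0..T})" if "t \<in> {0..T}" for t
    using sol that unfolding z_def F_def A_def hamiltonian_solution_def
    by (auto intro!: has_vector_derivative_Pair)
  \<comment> \<open>the velocity F is bounded by 2 H^2 along the solution, so within one step F changes by at most
      2 H times 2 H^2 dt\<close>
  have local: "norm (z (t + dt) - z t - dt *\<^sub>R F (z t)) \<le> 4 * H ^ 3 * dt\<^sup>2" if t: "0 \<le> t" "t + dt \<le> T" for t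
  proof -
    have d: "(z has_vector_derivative F (z s)) (at s within {t..t + dt})" if "s \<in> {t..t + dt}" for s
      by (rule has_vector_derivative_within_subset[OF dz]) (use that t in auto)
    have zb: "norm (z s) \<le> \<rho>" if "s \<in> {t..t + dt}" for s
      unfolding z_def by (rule exact) (use that t in auto)
    have inc: "norm (z s - z t) \<le> 2 * H\<^sup>2 * dt" if s: "s \<in> {t..t + dt}" for s
    proof -
      have "norm (z s - z t) \<le> 2 * H\<^sup>2 * norm (s - t)"
      proof (rule differentiable_bound[of "{t..t+dt}" z "\<lambda>s h. h *\<^sub>R F (z s)"])
        show "(z has_derivative (\<lambda>h. h *\<^sub>R F (z s))) (at s within {t..t + dt})" if "s \<in> {t..t + dt}" for s
          using d[OF that] by (simp add: has_vector_derivative_def)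
        show "onorm (\<lambda>h. h *\<^sub>R F (z s)) \<le> 2 * H\<^sup>2" if "s \<in> {t..t + dt}" for s
          by (rule onorm_bound) (use Fb[OF zb[OF that]] Hp in \<open>auto simp: mult.commute intro!: mult_left_mono mult_right_mono\<close>)
      qed (use s dt in auto)
      also have "\<dots> \<le> 2 * H\<^sup>2 * dt" using s by (intro mult_left_mono) auto
      finally show ?thesis .
    qed
    have "norm (z (t + dt) - z t - (t + dt - t) *\<^sub>R F (z t)) \<le> norm (t + dt - t) * (2 * H * (2 * H\<^sup>2 * dt))"
    proof (rule vector_differentiable_bound_linearization[OF d])
      show "norm (F (z s) - F (z t)) \<le> 2 * H * (2 * H\<^sup>2 * dt)" if "s \<in> {t..t + dt}" for s
      proof -
        have "norm (F (z s) - F (z t)) \<le> 2 * H * norm (z s - z t)"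
          by (rule FLip) (use zb that dt in auto)
        also have "\<dots> \<le> 2 * H * (2 * H\<^sup>2 * dt)" using inc[OF that] Hp by (intro mult_left_mono) auto
        finally show ?thesis .
      qed
    qed (use dt in \<open>auto simp: closed_segment_eq_real_ivl\<close>)
    then show ?thesis using dt by (simp add: power2_eq_square power3_eq_cube mult_ac)
  qed
  \<comment> \<open>the two half kicks, at the old and the new position, make up one full kick at the old position
      up to the Lipschitz estimate for a displacement of order dt\<close>
  have scheme: "norm (w (Suc k) - w k - dt *\<^sub>R F (w k)) \<le> 9 * H ^ 4 * dt\<^sup>2" if k: "Suc k \<le> N" for k
  proof -
    define p q where "p = fst (w k)" and "q = snd (w k)"
    define p' where "p' = fst (w (Suc k))"
    define G where "G = gradient U p"
    define G' where "G' = gradient U p'"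
    have wk: "norm (w k) \<le> \<rho>" "norm (w (Suc k)) \<le> \<rho>" using iter[of k] iter[of "Suc k"] k by (auto simp: w_def)
    have pq: "norm p \<le> H" "norm q \<le> H" "norm G \<le> H"
      using comp[OF wk(1)] comp[OF wk(2)] \<rho> grad[OF comp(1)[OF wk(1)]]
      by (auto simp: p_def q_def p'_def G_def)
    have wS: "w (Suc k) = (b *\<^sub>R p + dt *\<^sub>R A (a *\<^sub>R q - (dt / 2) *\<^sub>R G),
         a\<^sup>2 *\<^sub>R q - (dt / 2) *\<^sub>R (a *\<^sub>R G + G'))"
      by (simp add: w_def p'_def G'_def leapfrog_step_def Let_def p_def q_def G_def A_def case_prod_beta)
    have p': "p' - p - dt *\<^sub>R A q = (b - 1) *\<^sub>R p + (dt * (a - 1)) *\<^sub>R A q - (dt\<^sup>2 / 2) *\<^sub>R A G"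
      unfolding p'_def wS by (simp add: A algebra_simps power2_eq_square)
    have Aq: "norm (A q) \<le> H\<^sup>2" "norm (A G) \<le> H\<^sup>2"
      by (rule order_trans[OF A(3)]; use pq Hp in \<open>simp add: power2_eq_square\<close>)+
    have y1: "norm ((b - 1) *\<^sub>R p) \<le> H ^ 3 * dt\<^sup>2"
    proof -
      have "norm ((b - 1) *\<^sub>R p) \<le> (H * dt\<^sup>2) * H" unfolding norm_scaleR using b pq Hp by (intro mult_mono) auto
      also have "\<dots> = H\<^sup>2 * dt\<^sup>2" by (simp add: power2_eq_square)
      finally show ?thesis using mult_right_mono[OF Hp(4), of "dt\<^sup>2"] by simp
    qed
    have y2: "norm ((dt * (a - 1)) *\<^sub>R A q) \<le> H ^ 3 * dt\<^sup>2"
    proof -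
      have "norm ((dt * (a - 1)) *\<^sub>R A q) \<le> (1 * (H * dt\<^sup>2)) * H\<^sup>2"
        unfolding norm_scaleR abs_mult using a dt Aq Hp by (intro mult_mono) auto
      then show ?thesis by (simp add: power2_eq_square power3_eq_cube mult_ac)
    qed
    have y3: "norm ((dt\<^sup>2 / 2) *\<^sub>R A G) \<le> H ^ 3 * dt\<^sup>2"
    proof -
      have "norm ((dt\<^sup>2 / 2) *\<^sub>R A G) \<le> dt\<^sup>2 * H\<^sup>2"
        unfolding norm_scaleR using Aq by (intro mult_mono) auto
      then show ?thesis using mult_right_mono[OF Hp(4), of "dt\<^sup>2"] by (simp add: mult.commute)
    qed
    have Y: "norm (p' - p - dt *\<^sub>R A q) \<le> 3 * H ^ 3 * dt\<^sup>2"
      unfolding p' using norm_triangle_ineq[of "(b - 1) *\<^sub>R p" "(dt * (a - 1)) *\<^sub>R A q"]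
        norm_triangle_ineq4[of "(b - 1) *\<^sub>R p + (dt * (a - 1)) *\<^sub>R A q" "(dt\<^sup>2 / 2) *\<^sub>R A G"] y1 y2 y3
      by linarith
    have move: "norm (p' - p) \<le> 4 * H ^ 3 * dt"
    proof -
      have "norm (p' - p) \<le> norm (p' - p - dt *\<^sub>R A q) + norm (dt *\<^sub>R A q)"
        using norm_triangle_ineq[of "p' - p - dt *\<^sub>R A q" "dt *\<^sub>R A q"] by simp
      also have "\<dots> \<le> 3 * H ^ 3 * dt + H ^ 3 * dt"
      proof (rule add_mono)
        have "dt\<^sup>2 \<le> dt" using dt by (simp add: power2_eq_square mult_left_le)
        then have "3 * H ^ 3 * dt\<^sup>2 \<le> 3 * H ^ 3 * dt" using Hp by (intro mult_left_mono) auto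
        then show "norm (p' - p - dt *\<^sub>R A q) \<le> 3 * H ^ 3 * dt" using Y by linarith
        have "norm (A q) \<le> H ^ 3" using Aq Hp by linarith
        then show "norm (dt *\<^sub>R A q) \<le> H ^ 3 * dt" using dt by (simp add: mult.commute)
      qed
      finally show ?thesis by (simp add: mult_ac)
    qed
    have x': "snd (w (Suc k)) - q + dt *\<^sub>R G = (a\<^sup>2 - 1) *\<^sub>R q + (dt / 2 * (1 - a)) *\<^sub>R G + (dt / 2) *\<^sub>R (G - G')"
      unfolding wS by (simp add: algebra_simps) (simp add: scaleR_add_left[symmetric] diff_divide_distrib)
    have x1: "norm ((a\<^sup>2 - 1) *\<^sub>R q) \<le> 3 * H ^ 4 * dt\<^sup>2"
    proof -
      have "dt\<^sup>2 \<le> 1" using dt by (simp add: power_le_one)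
      then have "\<bar>a + 1\<bar> \<le> 3 * H" using a H mult_left_mono[of "dt\<^sup>2" 1 H] by linarith
      then have "\<bar>a - 1\<bar> * \<bar>a + 1\<bar> * norm q \<le> (H * dt\<^sup>2) * (3 * H) * H"
        using a pq Hp by (intro mult_mono) auto
      moreover have "\<bar>a\<^sup>2 - 1\<bar> = \<bar>a - 1\<bar> * \<bar>a + 1\<bar>"
        by (simp add: abs_mult[symmetric] algebra_simps power2_eq_square)
      ultimately have "norm ((a\<^sup>2 - 1) *\<^sub>R q) \<le> 3 * H ^ 3 * dt\<^sup>2"
        by (simp add: power2_eq_square power3_eq_cube mult_ac)
      then show ?thesis using mult_right_mono[OF Hp(5), of "3 * dt\<^sup>2"] by simp
    qed
    have x2: "norm ((dt / 2 * (1 - a)) *\<^sub>R G) \<le> H ^ 4 * dt\<^sup>2"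
    proof -
      have "norm ((dt / 2 * (1 - a)) *\<^sub>R G) \<le> (1 * (H * dt\<^sup>2)) * H"
        unfolding norm_scaleR abs_mult using a dt pq Hp by (intro mult_mono) auto
      then have "norm ((dt / 2 * (1 - a)) *\<^sub>R G) \<le> H\<^sup>2 * dt\<^sup>2"
        by (simp add: power2_eq_square mult_ac)
      also have "\<dots> \<le> H ^ 4 * dt\<^sup>2" using Hp by (intro mult_right_mono) auto
      finally show ?thesis .
    qed
    have x3: "norm ((dt / 2) *\<^sub>R (G - G')) \<le> 2 * H ^ 4 * dt\<^sup>2"
    proof -
      have "norm (G - G') \<le> H * norm (p - p')"
        unfolding G_def G'_def p_def p'_def using comp wk by (intro lip) auto
      also have "\<dots> \<le> H * (4 * H ^ 3 * dt)" using move Hp by (intro mult_left_mono) (auto simp: norm_minus_commute)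
      finally have "dt / 2 * norm (G - G') \<le> dt / 2 * (H * (4 * H ^ 3 * dt))"
        using dt by (intro mult_left_mono) auto
      also have "\<dots> = 2 * H ^ 4 * dt\<^sup>2" by (simp add: eval_nat_numeral)
      finally show ?thesis using dt by simp
    qed
    have X: "norm (snd (w (Suc k)) - q + dt *\<^sub>R G) \<le> 6 * H ^ 4 * dt\<^sup>2"
      unfolding x' using norm_triangle_ineq[of "(a\<^sup>2 - 1) *\<^sub>R q" "(dt / 2 * (1 - a)) *\<^sub>R G"]
        norm_triangle_ineq[of "(a\<^sup>2 - 1) *\<^sub>R q + (dt / 2 * (1 - a)) *\<^sub>R G" "(dt / 2) *\<^sub>R (G - G')"] x1 x2 x3
      by linarith
    have "w (Suc k) - w k - dt *\<^sub>R F (w k) = (p' - p - dt *\<^sub>R A q, snd (w (Suc k)) - q + dt *\<^sub>R G)"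
      by (simp add: prod_eq_iff p'_def p_def q_def F_def G_def)
    then have "norm (w (Suc k) - w k - dt *\<^sub>R F (w k)) \<le> 3 * H ^ 3 * dt\<^sup>2 + 6 * H ^ 4 * dt\<^sup>2"
      using norm_Pair_le[of "p' - p - dt *\<^sub>R A q" "snd (w (Suc k)) - q + dt *\<^sub>R G"] X Y by simp
    also have "\<dots> \<le> 9 * H ^ 4 * dt\<^sup>2" using mult_right_mono[OF Hp(5), of "dt\<^sup>2"] by (simp add: mult_ac)
    finally show ?thesis .
  qed
  define e where "e k = norm (z (real k * dt) - w k)" for k
  have acc: "e k \<le> real k * (13 * H ^ 4 * dt\<^sup>2) * (1 + 2 * H * dt) ^ k" if "k \<le> N" for k
    using that
  proof (induction k)
    case 0
    then show ?case using sol by (simp add: e_def z_def w_def hamiltonian_solution_def)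
  next
    case (Suc k)
    let ?t = "real k * dt" and ?K = "13 * H ^ 4 * dt\<^sup>2" and ?\<Lambda> = "1 + 2 * H * dt"
    have "real (Suc k) * dt \<le> real N * dt" using Suc.prems dt by (intro mult_right_mono) auto
    then have t: "0 \<le> ?t" "?t + dt \<le> T" using NT dt by (auto simp: algebra_simps)
    have tri: "norm (p1 + p2 + p3 - p4) \<le> norm p1 + norm p2 + norm p3 + norm p4"
      for p1 p2 p3 p4 :: "(real^'d) \<times> (real^'d)"
      using norm_triangle_ineq[of p1 p2] norm_triangle_ineq[of "p1 + p2" p3]
        norm_triangle_ineq4[of "p1 + p2 + p3" p4] by linarith
    have "z (real (Suc k) * dt) - w (Suc k) = (z ?t - w k) + dt *\<^sub>R (F (z ?t) - F (w k))
        + (z (?t + dt) - z ?t - dt *\<^sub>R F (z ?t)) - (w (Suc k) - w k - dt *\<^sub>R F (w k))"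
      by (simp add: algebra_simps)
    then have "e (Suc k) \<le> e k + norm (dt *\<^sub>R (F (z ?t) - F (w k)))
        + norm (z (?t + dt) - z ?t - dt *\<^sub>R F (z ?t)) + norm (w (Suc k) - w k - dt *\<^sub>R F (w k))"
      unfolding e_def by (simp only: tri)
    also have "norm (dt *\<^sub>R (F (z ?t) - F (w k))) \<le> dt * (2 * H * e k)"
    proof -
      have "norm (F (z ?t) - F (w k)) \<le> 2 * H * e k"
        unfolding e_def using t dt Suc.prems iter[of k] by (intro FLip) (auto simp: z_def w_def intro!: exact)
      then show ?thesis using dt by simp
    qed
    also have "norm (z (?t + dt) - z ?t - dt *\<^sub>R F (z ?t)) \<le> 4 * H ^ 4 * dt\<^sup>2"
      using local[OF t] mult_right_mono[OF Hp(5), of "dt\<^sup>2"] by simp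
    also have "norm (w (Suc k) - w k - dt *\<^sub>R F (w k)) \<le> 9 * H ^ 4 * dt\<^sup>2"
      by (rule scheme) fact
    finally have "e (Suc k) \<le> ?\<Lambda> * e k + ?K" by (simp add: algebra_simps)
    also have "\<dots> \<le> ?\<Lambda> * (real k * ?K * ?\<Lambda> ^ k) + ?K * ?\<Lambda> ^ Suc k"
    proof (rule add_mono)
      show "?\<Lambda> * e k \<le> ?\<Lambda> * (real k * ?K * ?\<Lambda> ^ k)"
        using Suc Hp dt by (intro mult_left_mono) auto
      have "1 \<le> ?\<Lambda> ^ Suc k" using Hp dt by (intro one_le_power) auto
      then show "?K \<le> ?K * ?\<Lambda> ^ Suc k" using mult_left_mono[of 1 "?\<Lambda> ^ Suc k" ?K] Hp by simp
    qed
    also have "\<dots> = real (Suc k) * ?K * ?\<Lambda> ^ Suc k" by (simp add: algebra_simps)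
    finally show ?case .
  qed
  have nT: "real n * dt \<le> T" using n dt NT by (meson mult_right_mono of_nat_mono less_imp_le order_trans)
  have "(1 + 2 * H * dt) ^ n \<le> exp (2 * H * dt) ^ n"
    using Hp dt by (intro power_mono exp_ge_add_one_self) auto
  also have "\<dots> = exp (2 * H * (real n * dt))" by (simp add: exp_of_nat_mult[symmetric] mult_ac)
  also have "\<dots> \<le> exp (2 * H * T)" using nT Hp by simp
  finally have ex: "(1 + 2 * H * dt) ^ n \<le> exp (2 * H * T)" .
  have "e n \<le> (real n * dt) * (13 * H ^ 4 * dt) * (1 + 2 * H * dt) ^ n"
    using acc[OF n] by (simp add: power2_eq_square mult_ac)
  also have "\<dots> \<le> T * (13 * H ^ 4 * dt) * exp (2 * H * T)"
  proof -
    have "0 \<le> real n * dt" using dt by simp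
    then have "0 \<le> T" using nT by linarith
    then show ?thesis using nT ex dt Hp by (intro mult_mono) auto
  qed
  finally show ?thesis by (simp add: e_def z_def w_def mult_ac)
qed

lemma matrix_vector_mult_bound:
  obtains \<mu> where "\<mu> \<ge> 0" and "\<And>v. norm ((A :: real^'n^'m) *v v) \<le> \<mu> * norm v"
  using onorm[OF matrix_vector_mul_bounded_linear[of A]] onorm_pos_le[OF matrix_vector_mul_bounded_linear[of A]]
  by blast

text \<open>On a ball that contains the iterates and also the compact path of the solution, the error bound applies with
constants that depend on the path but not on N. It therefore yields convergence, and the bound R passes from
the iterates to the solution, since every time is a limit of grid times.\<close>

lemma leapfrog_converges:
  fixes M :: "real^'d^'d" and U :: "real^'d \<Rightarrow> real" and y x :: "real \<Rightarrow> real^'d"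
  assumes T: "T > 0" and U: "C_k 2 U" and sol: "hamiltonian_solution M U T z\<^sub>0 y x"
    and ab: "eventually (\<lambda>N. \<bar>a N - 1\<bar> \<le> c * (T / real N)\<^sup>2 \<and> \<bar>b N - 1\<bar> \<le> c * (T / real N)\<^sup>2 \<and>
        (\<forall>n\<le>N. norm (leapfrog M U (a N) (b N) (T / real N) z\<^sub>0 n) \<le> R)) sequentially"
  shows "(\<lambda>N. leapfrog M U (a N) (b N) (T / real N) z\<^sub>0 N) \<longlonglongrightarrow> (y T, x T)"
    and "t \<in> {0..T} \<Longrightarrow> norm (y t, x t) \<le> R"
proof -
  define z where "z t = (y t, x t)" for t
  have zc: "continuous_on {0..T} z"
    unfolding z_def using sol
    by (intro continuous_on_Pair) (auto simp: hamiltonian_solution_def intro!: continuous_on_vector_derivative)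
  then have "bounded (z ` {0..T})" by (intro compact_imp_bounded compact_continuous_image) auto
  then obtain \<rho>' where "\<forall>t\<in>{0..T}. norm (z t) \<le> \<rho>'" by (auto simp: bounded_iff)
  then have \<rho>': "norm (z t) \<le> \<rho>'" if "t \<in> {0..T}" for t using that by blast
  define \<rho> where "\<rho> = max \<rho>' R"
  obtain L G where L: "\<And>p q. norm p \<le> \<rho> \<Longrightarrow> norm q \<le> \<rho> \<Longrightarrow> norm (gradient U p - gradient U q) \<le> L * norm (p - q)"
    and G: "\<And>p. norm p \<le> \<rho> \<Longrightarrow> norm (gradient U p) \<le> G"
    using gradient_locally_lipschitz_bounded[OF U, where \<rho> = \<rho>] by blast
  obtain \<mu> where \<mu>: "\<And>v. norm (matrix_inv M *v v) \<le> \<mu> * norm v" by (rule matrix_vector_mult_bound[of "matrix_inv M"]) blast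
  define H where "H = 1 + \<bar>\<rho>\<bar> + \<bar>L\<bar> + \<bar>G\<bar> + \<bar>\<mu>\<bar> + \<bar>c\<bar>"
  define K where "K = 13 * H ^ 4 * T * exp (2 * H * T)"
  have H: "1 \<le> H" "\<rho> \<le> H" "L \<le> H" "G \<le> H" "\<mu> \<le> H" "c \<le> H" unfolding H_def by linarith+
  have large: "eventually (\<lambda>N. N > 0 \<and> T / real N \<le> 1) sequentially"
    using eventually_ge_at_top[of "max 1 (nat \<lceil>T\<rceil>)"] by eventually_elim (auto simp: divide_le_eq; linarith)
  have err: "eventually (\<lambda>N. N > 0 \<and> (\<forall>n\<le>N. norm (z (real n * (T / real N)) - leapfrog M U (a N) (b N) (T / real N) z\<^sub>0 n)
       \<le> K * (T / real N) \<and> norm (leapfrog M U (a N) (b N) (T / real N) z\<^sub>0 n) \<le> R)) sequentially"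
    using large ab
  proof eventually_elim
    case (elim N)
    have "norm (z (real n * (T / real N)) - leapfrog M U (a N) (b N) (T / real N) z\<^sub>0 n) \<le> K * (T / real N)"
      if n: "n \<le> N" for n
      unfolding z_def K_def
    proof (rule leapfrog_error_bound[OF sol H(1) _ _ _ H(2)])
      show "norm (matrix_inv M *v v) \<le> H * norm v" for v
        using \<mu>[of v] mult_right_mono[OF H(5) norm_ge_zero[of v]] by linarith
      show "norm (gradient U p - gradient U q) \<le> H * norm (p - q)" if "norm p \<le> \<rho>" "norm q \<le> \<rho>" for p q
        using L[OF that] mult_right_mono[OF H(3) norm_ge_zero[of "p - q"]] by linarith
      show "norm (gradient U p) \<le> H" if "norm p \<le> \<rho>" for p using G[OF that] H by linarith
      show "norm (y t, x t) \<le> \<rho>" if "t \<in> {0..T}" for t using \<rho>'[OF that] by (simp add: z_def \<rho>_def)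
      show "norm (leapfrog M U (a N) (b N) (T / real N) z\<^sub>0 n) \<le> \<rho>" if "n \<le> N" for n
        using elim that by (auto simp: \<rho>_def le_max_iff_disj)
      show "\<bar>a N - 1\<bar> \<le> H * (T / real N)\<^sup>2" "\<bar>b N - 1\<bar> \<le> H * (T / real N)\<^sup>2"
        using elim mult_right_mono[OF H(6), of "(T / real N)\<^sup>2"] by auto
    qed (use elim T n in auto)
    with elim show ?case by auto
  qed
  have TN: "(\<lambda>N. C * (T / real N)) \<longlonglongrightarrow> 0" for C
    using tendsto_mult[OF tendsto_const[of C] lim_const_over_n[of T]] by simp
  show "(\<lambda>N. leapfrog M U (a N) (b N) (T / real N) z\<^sub>0 N) \<longlonglongrightarrow> (y T, x T)"
  proof (rule Lim_transform2[OF tendsto_const])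
    have "eventually (\<lambda>N. norm ((y T, x T) - leapfrog M U (a N) (b N) (T / real N) z\<^sub>0 N) \<le> K * (T / real N)) sequentially"
      using err
    proof eventually_elim
      case (elim N)
      then have "norm (z (real N * (T / real N)) - leapfrog M U (a N) (b N) (T / real N) z\<^sub>0 N) \<le> K * (T / real N)" by blast
      then show ?case using elim by (simp add: z_def)
    qed
    then show "(\<lambda>N. (y T, x T) - leapfrog M U (a N) (b N) (T / real N) z\<^sub>0 N) \<longlonglongrightarrow> 0"
      by (rule Lim_null_comparison[OF _ TN])
  qed
  show "norm (y t, x t) \<le> R" if t: "t \<in> {0..T}"
  proof -
    define s where "s N = real (nat \<lfloor>t * real N / T\<rfloor>) * (T / real N)" for N
    have fl: "real (nat \<lfloor>t * real N / T\<rfloor>) \<le> t * real N / T" "t * real N / T \<le> real (nat \<lfloor>t * real N / T\<rfloor>) + 1" for N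
      using t T by (simp_all add: of_nat_floor)
    have s: "0 \<le> s N" "s N \<le> t" "t - T / real N \<le> s N" if "N > 0" for N
    proof -
      show "0 \<le> s N" using T by (simp add: s_def)
      have "s N \<le> t * real N / T * (T / real N)" unfolding s_def using T by (intro mult_right_mono fl) auto
      then show "s N \<le> t" using T that by simp
      have "t * real N / T * (T / real N) \<le> (real (nat \<lfloor>t * real N / T\<rfloor>) + 1) * (T / real N)"
        using T by (intro mult_right_mono fl) auto
      then show "t - T / real N \<le> s N" using T that by (simp add: s_def distrib_right add_divide_distrib)
    qed
    have "s \<longlonglongrightarrow> t"
    proof (rule tendsto_sandwich)
      show "(\<lambda>N. t - 1 * (T / real N)) \<longlonglongrightarrow> t" using tendsto_diff[OF tendsto_const TN[of 1], of t] by simp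
      show "eventually (\<lambda>N. t - 1 * (T / real N) \<le> s N) sequentially"
        "eventually (\<lambda>N. s N \<le> t) sequentially"
        using eventually_gt_at_top[of 0] by (eventually_elim; use s in auto)+
    qed auto
    moreover have "eventually (\<lambda>N. s N \<in> {0..T}) sequentially"
      using eventually_gt_at_top[of 0] by eventually_elim (use s t in \<open>auto intro: order_trans\<close>)
    ultimately have "(\<lambda>N. z (s N)) \<longlonglongrightarrow> z t"
      by (intro continuous_on_tendsto_compose[OF zc _ t]) auto
    then have "(\<lambda>N. norm (z (s N))) \<longlonglongrightarrow> norm (z t)" by (rule tendsto_norm)
    moreover have "(\<lambda>N. R + K * (T / real N)) \<longlonglongrightarrow> R" using tendsto_add[OF tendsto_const TN, of R K] by simp
    moreover have "eventually (\<lambda>N. norm (z (s N)) \<le> R + K * (T / real N)) sequentially"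
      using err
    proof eventually_elim
      case (elim N)
      have "t * real N / T \<le> real N" using t T by (simp add: field_simps mult_right_mono)
      then have "nat \<lfloor>t * real N / T\<rfloor> \<le> N" using fl(1)[of N] by linarith
      with elim have "norm (z (s N) - leapfrog M U (a N) (b N) (T / real N) z\<^sub>0 (nat \<lfloor>t * real N / T\<rfloor>)) \<le> K * (T / real N)"
        "norm (leapfrog M U (a N) (b N) (T / real N) z\<^sub>0 (nat \<lfloor>t * real N / T\<rfloor>)) \<le> R"
        by (auto simp: s_def)
      then show ?case
        using norm_triangle_ineq2[of "z (s N)" "leapfrog M U (a N) (b N) (T / real N) z\<^sub>0 (nat \<lfloor>t * real N / T\<rfloor>)"] by linarith
    qed
    ultimately have "norm (z t) \<le> R" by (intro tendsto_le[OF _ _ _]) auto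
    then show ?thesis by (simp add: z_def)
  qed
qed

text \<open>The momentum x changes by at most 2 R during the time T, so by the mean value theorem there is a time at which
the component of the force in direction b is at most 2 R / T.\<close>

lemma force_bound_along_solution:
  fixes M :: "real^'d^'d" and U :: "real^'d \<Rightarrow> real" and y x :: "real \<Rightarrow> real^'d"
  assumes T: "T > 0" and sol: "hamiltonian_solution M U T z\<^sub>0 y x"
    and exact: "\<And>t. t \<in> {0..T} \<Longrightarrow> norm (y t, x t) \<le> R"
    and lip: "\<And>p q. \<lbrakk>norm p \<le> R; norm q \<le> R\<rbrakk> \<Longrightarrow> \<bar>partial_deriv b U p - partial_deriv b U q\<bar> \<le> S * norm (p - q)"
    and b: "b \<in> Basis" and S: "S \<ge> 0" and p: "norm p \<le> R"
  shows "\<bar>partial_deriv b U p\<bar> \<le> 2 * R / T + 2 * R * S"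
proof -
  have grad: "gradient U q \<bullet> b = partial_deriv b U q" for q
    using b by (simp add: gradient_def inner_sum_left inner_Basis if_distrib sum.delta cong: if_cong)
  have "\<exists>t\<in>{0<..<T}. x T \<bullet> b - x 0 \<bullet> b = (T - 0) * (- (gradient U (y t) \<bullet> b))"
  proof (rule mvt_simple[where f = "\<lambda>t. x t \<bullet> b" and f' = "\<lambda>t h. h * (- (gradient U (y t) \<bullet> b))", OF T])
    fix t assume "0 \<le> t" "t \<le> T"
    then have "(x has_vector_derivative - gradient U (y t)) (at t within {0..T})"
      using sol by (auto simp: hamiltonian_solution_def)
    then have "((\<lambda>t. x t \<bullet> b) has_derivative (\<lambda>h. (h *\<^sub>R (- gradient U (y t))) \<bullet> b)) (at t within {0..T})"
      unfolding has_vector_derivative_def by (rule has_derivative_inner_left)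
    then show "((\<lambda>t. x t \<bullet> b) has_derivative (\<lambda>h. h * (- (gradient U (y t) \<bullet> b)))) (at t within {0..T})"
      by simp
  qed
  then obtain t where t: "t \<in> {0<..<T}" "(x T - x 0) \<bullet> b = - T * partial_deriv b U (y t)"
    by (auto simp: grad inner_diff_left)
  have yx: "norm (y s) \<le> R" "norm (x s) \<le> R" if "s \<in> {0..T}" for s
    using exact[OF that] norm_fst_le[of "y s" "x s"] norm_snd_le[of "x s" "y s"] by auto
  have "T * \<bar>partial_deriv b U (y t)\<bar> = \<bar>(x T - x 0) \<bullet> b\<bar>" using t T by (simp add: abs_mult)
  also have "\<dots> \<le> norm (x T - x 0)" using b by (rule Basis_le_norm)
  also have "\<dots> \<le> 2 * R" using norm_triangle_ineq4[of "x T" "x 0"] yx[of T] yx[of 0] T by simp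
  finally have "\<bar>partial_deriv b U (y t)\<bar> \<le> 2 * R / T" using T by (simp add: field_simps)
  moreover have "\<bar>partial_deriv b U p - partial_deriv b U (y t)\<bar> \<le> S * (2 * R)"
  proof -
    have yt: "norm (y t) \<le> R" using t by (intro yx) auto
    have "\<bar>partial_deriv b U p - partial_deriv b U (y t)\<bar> \<le> S * norm (p - y t)" by (rule lip[OF p yt])
    also have "\<dots> \<le> S * (2 * R)" using norm_triangle_ineq4[of p "y t"] p yt S by (intro mult_left_mono) auto
    finally show ?thesis .
  qed
  ultimately show ?thesis by (simp add: mult_ac)
qed

text \<open>All data are bounded by H, which is affine in the Lipschitz constant S of the partial derivatives;
the polynomial factor H^4 is absorbed by exp (4 H). The exponent is therefore affine in S,
the form required by an exponential moment of S.\<close>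

lemma leapfrog_error_exponential_bound:
  fixes M :: "real^'d^'d" and U :: "real^'d \<Rightarrow> real" and y x :: "real \<Rightarrow> real^'d"
  assumes T: "T > 0" and sol: "hamiltonian_solution M U T z\<^sub>0 y x"
    and exact: "\<And>t. t \<in> {0..T} \<Longrightarrow> norm (y t, x t) \<le> R"
    and lip: "\<And>b p q. \<lbrakk>b \<in> Basis; norm p \<le> R; norm q \<le> R\<rbrakk> \<Longrightarrow>
                \<bar>partial_deriv b U p - partial_deriv b U q\<bar> \<le> S * norm (p - q)"
    and S: "S \<ge> 0" and inv: "\<And>v. norm (matrix_inv M *v v) \<le> \<mu> * norm v" and \<mu>: "\<mu> \<ge> 0"
    and iter: "\<And>n. n \<le> N \<Longrightarrow> norm (leapfrog M U a b dt z\<^sub>0 n) \<le> R"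
    and dt: "0 < dt" "dt \<le> 1" and NT: "real N * dt = T"
    and a: "\<bar>a - 1\<bar> \<le> c * dt\<^sup>2" and b: "\<bar>b - 1\<bar> \<le> c * dt\<^sup>2" and c: "c \<ge> 0"
  defines "H \<equiv> (1 + \<mu> + R + c + 2 * real CARD('d) * R / T) + real CARD('d) * (1 + 2 * R) * S"
  shows "norm ((y T, x T) - leapfrog M U a b dt z\<^sub>0 N) \<le> 13 * T * exp ((4 + 2 * T) * H) * dt"
proof -
  define d where "d = real CARD('d)"
  have R: "R \<ge> 0" using order_trans[OF norm_ge_zero exact[of 0]] T by auto
  have d: "d \<ge> 0" by (simp add: d_def)
  have nn: "0 \<le> d * R / T" "0 \<le> d * S" "0 \<le> d * R * S" using R d S T by auto
  have H': "H = 1 + \<mu> + R + c + 2 * (d * R / T) + d * S + 2 * (d * R * S)"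
    by (simp add: H_def d_def algebra_simps)
  have H: "1 \<le> H" "R \<le> H" "\<mu> \<le> H" "c \<le> H" "d * S \<le> H" "2 * (d * R / T) + 2 * (d * R * S) \<le> H"
    using nn R \<mu> c unfolding H' by linarith+
  have "norm ((y (real N * dt), x (real N * dt)) - leapfrog M U a b dt z\<^sub>0 N) \<le> 13 * H ^ 4 * T * exp (2 * H * T) * dt"
  proof (rule leapfrog_error_bound[OF sol H(1) _ _ _ H(2) exact iter dt])
    show "norm (matrix_inv M *v v) \<le> H * norm v" for v
      using inv[of v] mult_right_mono[OF H(3) norm_ge_zero[of v]] by linarith
    show "norm (gradient U p - gradient U q) \<le> H * norm (p - q)" if "norm p \<le> R" "norm q \<le> R" for p q
    proof -
      have "norm (gradient U p - gradient U q) \<le> DIM(real^'d) * (S * norm (p - q))"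
        by (intro norm_gradient_diff_le lip that)
      then show ?thesis
        using mult_right_mono[OF H(5) norm_ge_zero[of "p - q"]] by (simp add: d_def mult_ac)
    qed
    show "norm (gradient U p) \<le> H" if "norm p \<le> R" for p
    proof -
      have "norm (gradient U p) \<le> (\<Sum>b\<in>(Basis :: (real^'d) set). 2 * R / T + 2 * R * S)"
        unfolding gradient_def
      proof (rule sum_norm_le)
        fix b :: "real^'d" assume b: "b \<in> Basis"
        show "norm (partial_deriv b U p *\<^sub>R b) \<le> 2 * R / T + 2 * R * S"
          using force_bound_along_solution[OF T sol exact lip[OF b] b S that] b by simp
      qed
      also have "\<dots> = 2 * (d * R / T) + 2 * (d * R * S)" by (simp add: d_def algebra_simps)
      finally show ?thesis using H(6) by linarith
    qed
    show "\<bar>a - 1\<bar> \<le> H * dt\<^sup>2" "\<bar>b - 1\<bar> \<le> H * dt\<^sup>2"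
      using a b mult_right_mono[OF H(4), of "dt\<^sup>2"] by auto
  qed (use NT in auto)
  also have "\<dots> \<le> 13 * exp (4 * H) * T * exp (2 * H * T) * dt"
  proof -
    have "H ^ 4 \<le> exp H ^ 4"
      using H exp_ge_add_one_self[of H] by (intro power_mono) linarith+
    also have "\<dots> = exp (4 * H)" by (simp flip: exp_of_nat_mult)
    finally show ?thesis using T dt by (intro mult_right_mono mult_left_mono) auto
  qed
  also have "\<dots> = 13 * T * exp ((4 + 2 * T) * H) * dt"
  proof -
    have "exp ((4 + 2 * T) * H) = exp (4 * H) * exp (2 * H * T)"
      by (subst exp_add[symmetric]) (simp add: algebra_simps)
    then show ?thesis by simp
  qed
  finally show ?thesis using NT by simp
qed

section \<open>Measurability of the iterates\<close>

text \<open>Approximating Y by simple functions reduces the claim to countably many fixed values of q.\<close>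

lemma borel_measurable_caratheodory:
  fixes f :: "'b::{metric_space, second_countable_topology} \<Rightarrow> 'w \<Rightarrow> 'c::metric_space"
  assumes cont: "\<And>\<omega>. \<omega> \<in> space P \<Longrightarrow> continuous_on UNIV (\<lambda>q. f q \<omega>)"
    and meas: "\<And>q. f q \<in> borel_measurable P" and Y: "Y \<in> borel_measurable P"
  shows "(\<lambda>\<omega>. f (Y \<omega>) \<omega>) \<in> borel_measurable P"
proof -
  obtain F where F: "\<And>i. simple_function P (F i)" "\<And>\<omega>. \<omega> \<in> space P \<Longrightarrow> (\<lambda>i. F i \<omega>) \<longlonglongrightarrow> Y \<omega>"
    using borel_measurable_implies_sequence_metric[OF Y] by blast
  show ?thesis
  proof (rule borel_measurable_LIMSEQ_metric)
    fix i
    have fin: "finite (F i ` space P)" using F(1)[of i] by (simp add: simple_function_def)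
    have "F i \<in> measurable P (count_space (F i ` space P))"
      using F(1)[of i] by (subst measurable_count_space_eq2[OF fin]) (auto simp: simple_function_def)
    then show "(\<lambda>\<omega>. f (F i \<omega>) \<omega>) \<in> borel_measurable P"
      by (rule measurable_compose_countable'[OF meas]) (use fin in \<open>auto intro: countable_finite\<close>)
  next
    fix \<omega> assume w: "\<omega> \<in> space P"
    show "(\<lambda>i. f (F i \<omega>) \<omega>) \<longlonglongrightarrow> f (Y \<omega>) \<omega>"
      using continuous_on_tendsto_compose[OF cont[OF w] F(2)[OF w]] by simp
  qed
qed

lemma (in complete_measure) borel_measurable_AE_eq:
  fixes f g :: "'a \<Rightarrow> 'b::topological_space"
  assumes g: "g \<in> borel_measurable M" and eq: "AE \<omega> in M. f \<omega> = g \<omega>"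
  shows "f \<in> borel_measurable M"
proof (rule measurableI)
  fix S :: "'b set" assume S: "S \<in> sets borel"
  show "f -` S \<inter> space M \<in> sets M"
  proof (rule in_sets_AE)
    show "AE x in M. x \<in> g -` S \<inter> space M \<longleftrightarrow> x \<in> f -` S \<inter> space M"
      using eq by eventually_elim auto
  qed (use measurable_sets[OF g S] in auto)
qed auto

text \<open>The gradient is evaluated at the random point reached by the scheme. Off a null set it is continuous in
the point and, as a limit of difference quotients, measurable for each fixed point. On the null set
both the gradient and the iterates are replaced by 0, which is consistent with
the recursion; completeness transfers measurability back to the iterates.\<close>

lemma leapfrog_measurable:
  fixes V :: "real^'d \<Rightarrow> 'w \<Rightarrow> real" and M :: "real^'d^'d"
  assumes P: "complete_measure P"
    and V: "\<And>q. V q \<in> borel_measurable P"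
    and smooth: "AE \<omega> in P. C_k 1 (\<lambda>q. V q \<omega>)"
    and y0: "y\<^sub>0 \<in> borel_measurable P" and x0: "x\<^sub>0 \<in> borel_measurable P"
  shows "(\<lambda>\<omega>. leapfrog M (\<lambda>q. V q \<omega>) a b dt (y\<^sub>0 \<omega>, x\<^sub>0 \<omega>) n) \<in> borel_measurable P"
proof -
  interpret complete_measure P by fact
  note [measurable] = V y0 x0
  obtain N where N: "N \<in> null_sets P" "{\<omega> \<in> space P. \<not> C_k 1 (\<lambda>q. V q \<omega>)} \<subseteq> N"
    using smooth by (auto elim!: AE_E simp: null_sets_def)
  have [measurable]: "N \<in> sets P" using N(1) by auto
  define f where "f q \<omega> = (if \<omega> \<in> N then 0 else gradient (\<lambda>q. V q \<omega>) q)" for q \<omega>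
  have fm: "f q \<in> borel_measurable P" for q
  proof (rule borel_measurable_LIMSEQ_metric)
    fix \<omega> assume w: "\<omega> \<in> space P"
    show "(\<lambda>n. if \<omega> \<in> N then 0 else (\<Sum>b\<in>Basis. (real (Suc n) *
        (V (q + (1 / real (Suc n)) *\<^sub>R b) \<omega> - V q \<omega>)) *\<^sub>R b)) \<longlonglongrightarrow> f q \<omega>"
    proof (cases "\<omega> \<in> N")
      case False
      then have C: "C_k 1 (\<lambda>q. V q \<omega>)" using N w by auto
      show ?thesis
        using False by (simp add: f_def gradient_def del: of_nat_Suc)
          (intro tendsto_sum tendsto_scaleR tendsto_const C_k_difference_quotient[OF C]; simp)
    qed (simp add: f_def)
  qed measurable
  have fc: "continuous_on UNIV (\<lambda>q. f q \<omega>)" if w: "\<omega> \<in> space P" for \<omega>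
  proof (cases "\<omega> \<in> N")
    case False
    then have C: "C_k 1 (\<lambda>q. V q \<omega>)" using N w by auto
    show ?thesis
      using False by (simp add: f_def gradient_def) (intro continuous_intros C_k_continuous(1)[OF C]; simp)
  qed (simp add: f_def)
  have fY[measurable]: "(\<lambda>\<omega>. f (Y \<omega>) \<omega>) \<in> borel_measurable P" if "Y \<in> borel_measurable P" for Y
    by (rule borel_measurable_caratheodory[OF fc fm that])
  have [measurable]: "(\<lambda>v. matrix_inv M *v v) \<in> borel_measurable borel"
    by (intro borel_measurable_continuous_onI linear_continuous_on
         linear_conv_bounded_linear[THEN iffD1] matrix_vector_mul_linear)
  define w where "w n \<omega> = (if \<omega> \<in> N then 0 else leapfrog M (\<lambda>q. V q \<omega>) a b dt (y\<^sub>0 \<omega>, x\<^sub>0 \<omega>) n)" for n \<omega>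
  have "w n \<in> borel_measurable P" for n
  proof (induction n)
    case 0
    have "w 0 = (\<lambda>\<omega>. if \<omega> \<in> N then 0 else (y\<^sub>0 \<omega>, x\<^sub>0 \<omega>))" by (auto simp: w_def)
    then show ?case by simp
  next
    case (Suc n)
    note [measurable] = Suc
    have [measurable]: "(\<lambda>\<omega>. fst (w n \<omega>)) \<in> borel_measurable P" "(\<lambda>\<omega>. snd (w n \<omega>)) \<in> borel_measurable P"
      by (rule borel_measurable_continuous_on[OF _ Suc]; intro continuous_intros)+
    define y' where "y' \<omega> = b *\<^sub>R fst (w n \<omega>) + dt *\<^sub>R (matrix_inv M *v
        (a *\<^sub>R snd (w n \<omega>) - (dt / 2) *\<^sub>R f (fst (w n \<omega>)) \<omega>))" for \<omega>
    have [measurable]: "y' \<in> borel_measurable P" unfolding y'_def by measurable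
    have "w (Suc n) = (\<lambda>\<omega>. (y' \<omega>, a\<^sup>2 *\<^sub>R snd (w n \<omega>) - (dt / 2) *\<^sub>R (a *\<^sub>R f (fst (w n \<omega>)) \<omega> + f (y' \<omega>) \<omega>)))"
      by (rule ext) (simp add: w_def y'_def f_def leapfrog_step_def case_prod_beta Let_def zero_prod_def)
    also have "\<dots> \<in> borel_measurable P" by measurable
    finally show ?case .
  qed
  moreover have "AE \<omega> in P. leapfrog M (\<lambda>q. V q \<omega>) a b dt (y\<^sub>0 \<omega>, x\<^sub>0 \<omega>) n = w n \<omega>"
    using AE_not_in[OF N(1)] by eventually_elim (simp add: w_def)
  ultimately show ?thesis by (rule borel_measurable_AE_eq)
qed

section \<open>Random Lipschitz constants of the force and mean-square convergence\<close>

text \<open>A second difference is a combination of four values of the process, and the four points are indexed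
by pairs of truth values: the first selects the base point y or z, the second adds the step.\<close>

lemma second_differences_centred_gaussian:
  fixes V :: "'a::euclidean_space \<Rightarrow> 'w \<Rightarrow> real"
  assumes P: "prob_space P" and V: "gaussian_process P V" and I: "finite I"
  shows "centred_gaussian P (\<lambda>\<omega>. \<Sum>i\<in>I. a i * second_difference (\<lambda>q. V q \<omega> - mean_fun P V q) (idx i))"
proof -
  define pt where "pt i k = (case idx i of (y, z, b, n) \<Rightarrow>
      (if fst k then y else z) + (if snd k then (1 / real (Suc n)) *\<^sub>R b else 0))" for i and k :: "bool \<times> bool"
  define wt where "wt i k = (case idx i of (y, z, b, n) \<Rightarrow>
      real (Suc n) / norm (y - z) * (if fst k = snd k then 1 else - 1))" for i and k :: "bool \<times> bool"
  have sd: "second_difference f (idx i) = (\<Sum>k\<in>UNIV. wt i k * f (pt i k))" for f i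
    by (cases "idx i") (simp add: second_difference_def wt_def pt_def UNIV_Times_UNIV[symmetric]
        sum.cartesian_product[symmetric] UNIV_bool algebra_simps del: UNIV_Times_UNIV of_nat_Suc)
  have "centred_gaussian P (\<lambda>\<omega>. \<Sum>j\<in>I \<times> UNIV. (a (fst j) * wt (fst j) (snd j)) *
      (V (pt (fst j) (snd j)) \<omega> - mean_fun P V (pt (fst j) (snd j))))"
    by (rule gaussian_process_combination[OF P V]) (use I in auto)
  also have "(\<lambda>\<omega>. \<Sum>j\<in>I \<times> UNIV. (a (fst j) * wt (fst j) (snd j)) *
      (V (pt (fst j) (snd j)) \<omega> - mean_fun P V (pt (fst j) (snd j)))) =
      (\<lambda>\<omega>. \<Sum>i\<in>I. a i * second_difference (\<lambda>q. V q \<omega> - mean_fun P V q) (idx i))"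
    unfolding sd sum_distrib_left sum.cartesian_product by (simp add: case_prod_beta mult.assoc)
  finally show ?thesis .
qed

text \<open>The difference quotients are indexed by a countable dense set of base points in an open ball
that contains the closed ball of radius R. Smooth paths have bounded second differences there, so Fernique's theorem
applies. The second differences of the mean contribute only the constant Km, because the mean is
itself of class C 2.\<close>

lemma gaussian_gradient_lipschitz_exponential_moment:
  fixes V :: "'a::euclidean_space \<Rightarrow> 'w \<Rightarrow> real" and R \<kappa> :: real
  assumes P: "prob_space P" and V: "gaussian_process P V"
    and mean: "C_k 2 (mean_fun P V)" and smooth: "AE \<omega> in P. C_k 2 (\<lambda>q. V q \<omega>)"
    and R: "R \<ge> 0" and \<kappa>: "\<kappa> > 0"
  obtains S where "\<And>\<omega>. S \<omega> \<ge> 0" and "\<exists>g. integrable P g \<and> (AE \<omega> in P. exp (\<kappa> * S \<omega>) \<le> g \<omega>)"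
    and "AE \<omega> in P. \<forall>b\<in>Basis. \<forall>p q. norm p \<le> R \<longrightarrow> norm q \<le> R \<longrightarrow>
           \<bar>partial_deriv b (\<lambda>q. V q \<omega>) p - partial_deriv b (\<lambda>q. V q \<omega>) q\<bar> \<le> S \<omega> * norm (p - q)"
proof -
  obtain D :: "'a set" where D: "countable D" "\<And>X. open X \<Longrightarrow> X \<noteq> {} \<Longrightarrow> \<exists>d\<in>D. d \<in> X"
    using countable_dense_exists[where 'a = 'a] by auto
  have dense: "closure D = UNIV"
  proof -
    have "x \<in> closure D" for x
      unfolding closure_iff_nhds_not_empty
    proof (intro allI impI)
      fix A B :: "'a set" assume "B \<subseteq> A" "open B" "x \<in> B"
      moreover from this obtain d where "d \<in> D" "d \<in> B" using D(2)[of B] by blast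
      ultimately show "D \<inter> A \<noteq> {}" by blast
    qed
    then show ?thesis by blast
  qed
  define r where "r = R + 1"
  define J where "J = (D \<inter> ball 0 r) \<times> (D \<inter> ball 0 r) \<times> (Basis :: 'a set) \<times> (UNIV :: nat set)"
  define idx where "idx = from_nat_into J"
  have "ball (0::'a) r \<noteq> {}" using R by (simp add: r_def)
  then have "D \<inter> ball 0 r \<noteq> {}" using D(2)[of "ball 0 r"] by auto
  then have "J \<noteq> {}" by (simp add: J_def)
  moreover have "countable J"
    unfolding J_def using D(1)
    by (intro countable_SIGMA countable_Int1) (auto intro: countable_finite)
  ultimately have idx: "range idx = J" by (simp add: idx_def range_from_nat_into)
  define X where "X i \<omega> = second_difference (\<lambda>q. V q \<omega> - mean_fun P V q) (idx i)" for i \<omega>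
  have bounded: "\<exists>K. \<forall>i. \<bar>second_difference f (idx i)\<bar> \<le> K" if f: "C_k 2 f" for f
  proof -
    obtain K where K: "\<And>y z b n. \<lbrakk>norm y \<le> r; norm z \<le> r; b \<in> Basis\<rbrakk> \<Longrightarrow> \<bar>second_difference f (y, z, b, n)\<bar> \<le> K"
      using second_difference_bounded[OF f] by blast
    have "\<bar>second_difference f (idx i)\<bar> \<le> K" for i
      using rangeI[of idx i] unfolding idx J_def by (auto intro!: K)
    then show ?thesis by blast
  qed
  obtain Km where Km: "\<And>i. \<bar>second_difference (mean_fun P V) (idx i)\<bar> \<le> Km" using bounded[OF mean] by blast
  have split: "X i \<omega> = second_difference (\<lambda>q. V q \<omega>) (idx i) - second_difference (mean_fun P V) (idx i)" for i \<omega>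
    by (cases "idx i") (simp add: X_def second_difference_def algebra_simps del: of_nat_Suc)
  have Xb: "AE \<omega> in P. \<exists>K. \<forall>i. \<bar>X i \<omega>\<bar> \<le> K"
    using smooth
  proof eventually_elim
    case (elim \<omega>)
    then obtain K where "\<And>i. \<bar>second_difference (\<lambda>q. V q \<omega>) (idx i)\<bar> \<le> K" using bounded by blast
    then have "\<bar>X i \<omega>\<bar> \<le> K + Km" for i unfolding split using Km[of i] abs_triangle_ineq4 by (meson add_mono order_trans)
    then show ?case by blast
  qed
  have X: "centred_gaussian P (\<lambda>\<omega>. \<Sum>i\<in>I. a i * X i \<omega>)" if "finite I" for I a
    unfolding X_def by (rule second_differences_centred_gaussian[OF P V that])
  obtain g where g: "integrable P g" "AE \<omega> in P. \<forall>i. exp (\<kappa> * \<bar>X i \<omega>\<bar>) \<le> g \<omega>"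
    by (rule fernique_exponential_moment[OF P X Xb less_imp_le[OF \<kappa>]])
  have "Km \<ge> 0" using order_trans[OF abs_ge_zero Km] by blast
  \<comment> \<open>the logarithm of the dominating function bounds all second differences of the centred process;
      the maximum with 1 keeps S nonnegative on the exceptional null set as well\<close>
  define S where "S \<omega> = ln (max 1 (g \<omega>)) / \<kappa> + Km" for \<omega>
  show thesis
  proof
    show S0: "S \<omega> \<ge> 0" for \<omega> using \<kappa> \<open>Km \<ge> 0\<close> by (simp add: S_def)
    have "AE \<omega> in P. exp (\<kappa> * S \<omega>) \<le> exp (\<kappa> * Km) * g \<omega>"
      using g(2)
    proof eventually_elim
      case (elim \<omega>)
      have "1 \<le> exp (\<kappa> * \<bar>X 0 \<omega>\<bar>)" using \<kappa> by simp
      then have "max 1 (g \<omega>) = g \<omega>" "g \<omega> > 0" using elim[rule_format, of 0] by linarith+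
      then show ?case using \<kappa> by (simp add: S_def distrib_left exp_add)
    qed
    then show "\<exists>g. integrable P g \<and> (AE \<omega> in P. exp (\<kappa> * S \<omega>) \<le> g \<omega>)"
      using g(1) by (intro exI[of _ "\<lambda>\<omega>. exp (\<kappa> * Km) * g \<omega>"]) auto
    show "AE \<omega> in P. \<forall>b\<in>Basis. \<forall>p q. norm p \<le> R \<longrightarrow> norm q \<le> R \<longrightarrow>
           \<bar>partial_deriv b (\<lambda>q. V q \<omega>) p - partial_deriv b (\<lambda>q. V q \<omega>) q\<bar> \<le> S \<omega> * norm (p - q)"
      using g(2) smooth
    proof eventually_elim
      case (elim \<omega>)
      have "\<bar>second_difference (\<lambda>q. V q \<omega>) (idx i)\<bar> \<le> S \<omega>" for i
      proof -
        have "exp (\<kappa> * \<bar>X i \<omega>\<bar>) \<le> max 1 (g \<omega>)" using elim(1) by (simp add: le_max_iff_disj)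
        then have "\<kappa> * \<bar>X i \<omega>\<bar> \<le> ln (max 1 (g \<omega>))" by (subst ln_ge_iff) auto
        then have "\<bar>X i \<omega>\<bar> \<le> ln (max 1 (g \<omega>)) / \<kappa>" using \<kappa> by (simp add: field_simps)
        then show ?thesis using Km[of i] unfolding split S_def by linarith
      qed
      then have sd: "\<bar>second_difference (\<lambda>q. V q \<omega>) j\<bar> \<le> S \<omega>" if "j \<in> J" for j
        using that idx by (metis imageE)
      show ?case
      proof (intro ballI allI impI)
        fix b p q :: 'a assume b: "b \<in> Basis" and "norm p \<le> R" "norm q \<le> R"
        then show "\<bar>partial_deriv b (\<lambda>q. V q \<omega>) p - partial_deriv b (\<lambda>q. V q \<omega>) q\<bar> \<le> S \<omega> * norm (p - q)"
          using b by (intro partial_deriv_lipschitz_from_second_difference[OF elim(2) dense b S0, where r = r] sd)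
            (auto simp: r_def J_def)
      qed
    qed
  qed
qed

theorem theorem5p1:
  fixes P :: "'w measure"
    and V :: "real^'d \<Rightarrow> 'w \<Rightarrow> real"
    and M :: "real^'d^'d"
    and T R \<alpha>\<^sub>2 \<beta>\<^sub>2 C\<^sub>\<alpha> C\<^sub>\<beta> :: real
    and \<alpha> \<beta> \<alpha>_rem \<beta>_rem :: "real \<Rightarrow> real"
    and y\<^sub>0 x\<^sub>0 :: "'w \<Rightarrow> real^'d"
    and y x :: "real \<Rightarrow> 'w \<Rightarrow> real^'d"
  assumes "prob_space P" and "complete_measure P"
    and "gaussian_process P V"
    and "C_k 3 (mean_fun P V)"
    and "C_k 6 (cov_fun P V)" and "bounded_partials 6 (cov_fun P V)"
    and "AE \<omega> in P. C_k 3 (\<lambda>q. V q \<omega>)"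
    and "sym_pos_def M"
    and "T > 0"
    and "\<forall>dt>0. \<alpha> dt = 1 + \<alpha>\<^sub>2 * dt\<^sup>2 + \<alpha>_rem dt"
    and "\<forall>dt>0. \<beta> dt = 1 + \<beta>\<^sub>2 * dt\<^sup>2 + \<beta>_rem dt"
    and "C\<^sub>\<alpha> > 0" and "\<forall>\<^sub>F dt in at_right 0. \<bar>\<alpha>_rem dt\<bar> \<le> C\<^sub>\<alpha> * dt ^ 3"
    and "C\<^sub>\<beta> > 0" and "\<forall>\<^sub>F dt in at_right 0. \<bar>\<beta>_rem dt\<bar> \<le> C\<^sub>\<beta> * dt ^ 3"
    and "y\<^sub>0 \<in> borel_measurable P" and "x\<^sub>0 \<in> borel_measurable P"
    and "R > 0"
    and "\<forall>\<^sub>F dt in at_right 0.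
           measure P {\<omega> \<in> space P.
             (SUP n\<in>{n. real n \<le> T / dt}.
                norm (leapfrog M (\<lambda>q. V q \<omega>) (\<alpha> dt) (\<beta> dt) dt (y\<^sub>0 \<omega>, x\<^sub>0 \<omega>) n)) \<le> R} = 1"
    and "AE \<omega> in P. hamiltonian_solution M (\<lambda>q. V q \<omega>) T (y\<^sub>0 \<omega>, x\<^sub>0 \<omega>)
                      (\<lambda>t. y t \<omega>) (\<lambda>t. x t \<omega>)"
  shows "\<exists>C\<^sub>T. \<forall>\<^sub>F dt in at_right 0. \<forall>N::nat. T / dt = real N \<longrightarrow>
           (let err = (\<lambda>\<omega>. (y T \<omega>, x T \<omega>) -
                  leapfrog M (\<lambda>q. V q \<omega>) (\<alpha> dt) (\<beta> dt) dt (y\<^sub>0 \<omega>, x\<^sub>0 \<omega>) N)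
            in integrable P (\<lambda>\<omega>. (norm (err \<omega>))\<^sup>2) \<and>
               sqrt (\<integral>\<omega>. (norm (err \<omega>))\<^sup>2 \<partial>P) \<le> C\<^sub>T * dt)"
proof -
  interpret prob_space P by fact
  interpret complete_measure P by fact
  note P = \<open>prob_space P\<close> and T = \<open>T > 0\<close> and R = \<open>R > 0\<close>
  have Vm: "V q \<in> borel_measurable P" for q using \<open>gaussian_process P V\<close> by (simp add: gaussian_process_def)
  have smooth: "AE \<omega> in P. C_k j (\<lambda>q. V q \<omega>)" if "j \<le> 3" for j
    using \<open>AE \<omega> in P. C_k 3 (\<lambda>q. V q \<omega>)\<close> by eventually_elim (use that C_k_mono in blast)
  define lf where "lf dt \<omega> n = leapfrog M (\<lambda>q. V q \<omega>) (\<alpha> dt) (\<beta> dt) dt (y\<^sub>0 \<omega>, x\<^sub>0 \<omega>) n" for dt \<omega> n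
  define c where "c = \<bar>\<alpha>\<^sub>2\<bar> + \<bar>\<beta>\<^sub>2\<bar> + C\<^sub>\<alpha> + C\<^sub>\<beta>"
  have c: "c \<ge> 0" using \<open>C\<^sub>\<alpha> > 0\<close> \<open>C\<^sub>\<beta> > 0\<close> by (simp add: c_def)
  have lfm[measurable]: "(\<lambda>\<omega>. lf dt \<omega> n) \<in> borel_measurable P" for dt n
    unfolding lf_def by (rule leapfrog_measurable) (use assms Vm smooth in auto)

  \<comment> \<open>a set of probability 1 in the sense of the total function \<open>measure\<close> is measurable, since a
      non-measurable set has measure 0; and the supremum is over a finite set\<close>
  have "\<forall>\<^sub>F dt in at_right 0. dt \<le> 1 \<and> \<bar>\<alpha> dt - 1\<bar> \<le> c * dt\<^sup>2 \<and> \<bar>\<beta> dt - 1\<bar> \<le> c * dt\<^sup>2 \<and>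
      (AE \<omega> in P. \<forall>n. real n \<le> T / dt \<longrightarrow> norm (lf dt \<omega> n) \<le> R)"
    using \<open>\<forall>\<^sub>F dt in at_right 0. \<bar>\<alpha>_rem dt\<bar> \<le> C\<^sub>\<alpha> * dt ^ 3\<close> \<open>\<forall>\<^sub>F dt in at_right 0. \<bar>\<beta>_rem dt\<bar> \<le> C\<^sub>\<beta> * dt ^ 3\<close>
      assms(19) eventually_at_right_less[of 0] eventually_at_right_real[of 0 "1::real", simplified]
  proof eventually_elim
    case (elim dt)
    have dt: "0 < dt" "dt < 1" using elim by auto
    have cube: "C * dt ^ 3 \<le> C * dt\<^sup>2" if "C > 0" for C
      using that dt by (intro mult_left_mono power_decreasing) auto
    have scale: "(\<bar>\<alpha>\<^sub>2\<bar> + C\<^sub>\<alpha>) * dt\<^sup>2 \<le> c * dt\<^sup>2" "(\<bar>\<beta>\<^sub>2\<bar> + C\<^sub>\<beta>) * dt\<^sup>2 \<le> c * dt\<^sup>2"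
      using \<open>C\<^sub>\<alpha> > 0\<close> \<open>C\<^sub>\<beta> > 0\<close> by (intro mult_right_mono; simp add: c_def)+
    have "\<bar>\<alpha> dt - 1\<bar> \<le> \<bar>\<alpha>\<^sub>2 * dt\<^sup>2\<bar> + \<bar>\<alpha>_rem dt\<bar>" using assms(10) dt by auto
    also have "\<dots> \<le> (\<bar>\<alpha>\<^sub>2\<bar> + C\<^sub>\<alpha>) * dt\<^sup>2"
      using elim(1) cube[OF \<open>C\<^sub>\<alpha> > 0\<close>] by (simp add: abs_mult distrib_right)
    finally have \<alpha>: "\<bar>\<alpha> dt - 1\<bar> \<le> c * dt\<^sup>2" using scale by linarith
    have "\<bar>\<beta> dt - 1\<bar> \<le> \<bar>\<beta>\<^sub>2 * dt\<^sup>2\<bar> + \<bar>\<beta>_rem dt\<bar>" using assms(11) dt by auto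
    also have "\<dots> \<le> (\<bar>\<beta>\<^sub>2\<bar> + C\<^sub>\<beta>) * dt\<^sup>2"
      using elim(2) cube[OF \<open>C\<^sub>\<beta> > 0\<close>] by (simp add: abs_mult distrib_right)
    finally have \<beta>: "\<bar>\<beta> dt - 1\<bar> \<le> c * dt\<^sup>2" using scale by linarith
    have fin: "finite {n. real n \<le> T / dt}"
      by (rule finite_subset[of _ "{..nat \<lfloor>T / dt\<rfloor>}"]) (auto simp: le_nat_floor)
    have "AE \<omega> in P. \<omega> \<in> {\<omega> \<in> space P. (SUP n\<in>{n. real n \<le> T / dt}. norm (lf dt \<omega> n)) \<le> R}"
      by (rule AE_prob_1) (use elim(3) in \<open>simp add: lf_def\<close>)
    then have "AE \<omega> in P. \<forall>n. real n \<le> T / dt \<longrightarrow> norm (lf dt \<omega> n) \<le> R"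
    proof eventually_elim
      case (elim \<omega>)
      show ?case
      proof (intro allI impI)
        fix n assume "real n \<le> T / dt"
        then have "norm (lf dt \<omega> n) \<le> (SUP n\<in>{n. real n \<le> T / dt}. norm (lf dt \<omega> n))"
          using fin by (intro cSUP_upper bdd_above_finite) auto
        then show "norm (lf dt \<omega> n) \<le> R" using elim by simp
      qed
    qed
    with \<alpha> \<beta> dt show ?case by simp
  qed
  then obtain \<delta> where \<delta>: "\<delta> > 0" "\<And>dt. 0 < dt \<Longrightarrow> dt < \<delta> \<Longrightarrow> dt \<le> 1 \<and> \<bar>\<alpha> dt - 1\<bar> \<le> c * dt\<^sup>2 \<and> \<bar>\<beta> dt - 1\<bar> \<le> c * dt\<^sup>2 \<and>
      (AE \<omega> in P. \<forall>n. real n \<le> T / dt \<longrightarrow> norm (lf dt \<omega> n) \<le> R)"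
    unfolding eventually_at_right_field by blast

  \<comment> \<open>only the countably many step sizes T / N matter, so one null set serves all of them\<close>
  have iter: "AE \<omega> in P. \<forall>N. 0 < N \<and> T / real N < \<delta> \<longrightarrow> (\<forall>n\<le>N. norm (lf (T / real N) \<omega> n) \<le> R)"
    unfolding AE_all_countable
  proof
    fix N :: nat
    show "AE \<omega> in P. 0 < N \<and> T / real N < \<delta> \<longrightarrow> (\<forall>n\<le>N. norm (lf (T / real N) \<omega> n) \<le> R)"
    proof (cases "0 < N \<and> T / real N < \<delta>")
      case True
      then have "AE \<omega> in P. \<forall>n. real n \<le> T / (T / real N) \<longrightarrow> norm (lf (T / real N) \<omega> n) \<le> R"
        using \<delta>(2)[of "T / real N"] T by auto
      then show ?thesis by eventually_elim (use T in auto)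
    qed auto
  qed
  have large: "eventually (\<lambda>N. 0 < N \<and> T / real N < \<delta>) sequentially"
    using order_tendstoD(2)[OF lim_const_over_n[of T] \<delta>(1)] eventually_gt_at_top[of 0] by eventually_elim simp

  have limit: "AE \<omega> in P. (\<lambda>N. lf (T / real N) \<omega> N) \<longlonglongrightarrow> (y T \<omega>, x T \<omega>) \<and>
      (\<forall>t\<in>{0..T}. norm (y t \<omega>, x t \<omega>) \<le> R)"
    using iter smooth[of 2, simplified] assms(20)
  proof eventually_elim
    case (elim \<omega>)
    have "eventually (\<lambda>N. \<bar>\<alpha> (T / real N) - 1\<bar> \<le> c * (T / real N)\<^sup>2 \<and> \<bar>\<beta> (T / real N) - 1\<bar> \<le> c * (T / real N)\<^sup>2 \<and>
        (\<forall>n\<le>N. norm (leapfrog M (\<lambda>q. V q \<omega>) (\<alpha> (T / real N)) (\<beta> (T / real N)) (T / real N) (y\<^sub>0 \<omega>, x\<^sub>0 \<omega>) n) \<le> R)) sequentially"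
      using large by eventually_elim (use \<delta>(2)[of "T / real _"] T elim(1) in \<open>auto simp: lf_def\<close>)
    note conv = leapfrog_converges[OF T elim(2,3) this]
    show ?case using conv by (auto simp: lf_def)
  qed
  \<comment> \<open>the solution is not assumed to be measurable; it is an almost sure limit of iterates\<close>
  have zm[measurable]: "(\<lambda>\<omega>. (y T \<omega>, x T \<omega>)) \<in> borel_measurable P"
  proof (rule borel_measurable_AE_eq)
    show "(\<lambda>\<omega>. lim (\<lambda>N. lf (T / real N) \<omega> N)) \<in> borel_measurable P"
      by (rule borel_measurable_lim_metric) measurable
    show "AE \<omega> in P. (y T \<omega>, x T \<omega>) = lim (\<lambda>N. lf (T / real N) \<omega> N)"
      using limit
    proof eventually_elim
      case (elim \<omega>)
      then have "lim (\<lambda>N. lf (T / real N) \<omega> N) = (y T \<omega>, x T \<omega>)" by (intro limI) blast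
      then show ?case by simp
    qed
  qed

  obtain \<mu> where \<mu>: "\<mu> \<ge> 0" "\<And>v. norm (matrix_inv M *v v) \<le> \<mu> * norm v"
    by (rule matrix_vector_mult_bound[of "matrix_inv M"]) blast
  define h\<^sub>0 where "h\<^sub>0 = 1 + \<mu> + R + c + 2 * real CARD('d) * R / T"
  define h\<^sub>1 where "h\<^sub>1 = real CARD('d) * (1 + 2 * R)"
  \<comment> \<open>the coefficient of S in the exponent of the squared error\<close>
  define \<kappa> where "\<kappa> = 2 * (4 + 2 * T) * h\<^sub>1"
  have "\<kappa> > 0" using T R by (simp add: \<kappa>_def h\<^sub>1_def)
  obtain S where S0: "\<And>\<omega>. S \<omega> \<ge> 0"
    and Sg: "\<exists>g. integrable P g \<and> (AE \<omega> in P. exp (\<kappa> * S \<omega>) \<le> g \<omega>)"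
    and Slip: "AE \<omega> in P. \<forall>b\<in>Basis. \<forall>p q. norm p \<le> R \<longrightarrow> norm q \<le> R \<longrightarrow>
           \<bar>partial_deriv b (\<lambda>q. V q \<omega>) p - partial_deriv b (\<lambda>q. V q \<omega>) q\<bar> \<le> S \<omega> * norm (p - q)"
    by (rule gaussian_gradient_lipschitz_exponential_moment[OF P \<open>gaussian_process P V\<close>
          C_k_mono[OF \<open>C_k 3 (mean_fun P V)\<close>] smooth less_imp_le[OF R] \<open>\<kappa> > 0\<close>]) auto
  obtain g where g: "integrable P g" "AE \<omega> in P. exp (\<kappa> * S \<omega>) \<le> g \<omega>" using Sg by blast
  define K where "K = (13 * T)\<^sup>2 * exp (2 * (4 + 2 * T) * h\<^sub>0)"
  have K: "K \<ge> 0" by (simp add: K_def)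

  have main: "integrable P (\<lambda>\<omega>. (norm ((y T \<omega>, x T \<omega>) - lf dt \<omega> N))\<^sup>2) \<and>
      sqrt (\<integral>\<omega>. (norm ((y T \<omega>, x T \<omega>) - lf dt \<omega> N))\<^sup>2 \<partial>P) \<le> sqrt (K * integral\<^sup>L P g) * dt"
    if dt: "0 < dt" "dt < \<delta>" and N: "T / dt = real N" for dt and N :: nat
  proof -
    have N0: "N > 0" using N T dt by (cases N) auto
    have dtN: "dt = T / real N" using N N0 dt T by (auto simp: field_simps)
    have bound: "AE \<omega> in P. (norm ((y T \<omega>, x T \<omega>) - lf dt \<omega> N))\<^sup>2 \<le> (K * dt\<^sup>2) * g \<omega>"
      using iter limit Slip g(2) assms(20)
    proof eventually_elim
      case (elim \<omega>)
      have "norm ((y T \<omega>, x T \<omega>) - lf dt \<omega> N) \<le> 13 * T * exp ((4 + 2 * T) * (h\<^sub>0 + h\<^sub>1 * S \<omega>)) * dt"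
        unfolding lf_def h\<^sub>0_def h\<^sub>1_def
      proof (rule leapfrog_error_exponential_bound[OF T elim(5) _ _ S0 \<mu>(2) \<mu>(1) _ _ _ _ _ _ c])
        show "norm (leapfrog M (\<lambda>q. V q \<omega>) (\<alpha> dt) (\<beta> dt) dt (y\<^sub>0 \<omega>, x\<^sub>0 \<omega>) n) \<le> R" if "n \<le> N" for n
          using elim(1) that dt N0 by (auto simp: lf_def dtN)
      qed (use elim \<delta>(2)[OF dt] dt N T in \<open>auto simp: field_simps\<close>)
      then have "(norm ((y T \<omega>, x T \<omega>) - lf dt \<omega> N))\<^sup>2 \<le> (13 * T * exp ((4 + 2 * T) * (h\<^sub>0 + h\<^sub>1 * S \<omega>)) * dt)\<^sup>2"
        by (intro power_mono) auto
      also have "\<dots> = (K * dt\<^sup>2) * exp (\<kappa> * S \<omega>)"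
        by (simp add: K_def \<kappa>_def power_mult_distrib exp_double[symmetric] exp_add[symmetric] algebra_simps)
      also have "\<dots> \<le> (K * dt\<^sup>2) * g \<omega>" using elim(4) K by (intro mult_left_mono) auto
      finally show ?case .
    qed
    have int: "integrable P (\<lambda>\<omega>. (norm ((y T \<omega>, x T \<omega>) - lf dt \<omega> N))\<^sup>2)"
    proof (rule Bochner_Integration.integrable_bound)
      show "integrable P (\<lambda>\<omega>. (K * dt\<^sup>2) * g \<omega>)" using g(1) by simp
      show "AE \<omega> in P. norm ((norm ((y T \<omega>, x T \<omega>) - lf dt \<omega> N))\<^sup>2) \<le> norm ((K * dt\<^sup>2) * g \<omega>)"
        using bound by eventually_elim simp
    qed measurable
    have "(\<integral>\<omega>. (norm ((y T \<omega>, x T \<omega>) - lf dt \<omega> N))\<^sup>2 \<partial>P) \<le> (\<integral>\<omega>. (K * dt\<^sup>2) * g \<omega> \<partial>P)"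
      by (intro integral_mono_AE int bound) (use g(1) in simp)
    then have "sqrt (\<integral>\<omega>. (norm ((y T \<omega>, x T \<omega>) - lf dt \<omega> N))\<^sup>2 \<partial>P) \<le> sqrt (K * integral\<^sup>L P g * dt\<^sup>2)"
      by (simp add: mult_ac)
    also have "\<dots> = sqrt (K * integral\<^sup>L P g) * dt" using dt by (simp add: real_sqrt_mult)
    finally show ?thesis using int by simp
  qed
  have "\<forall>dt>0. dt < \<delta> \<longrightarrow> (\<forall>N::nat. T / dt = real N \<longrightarrow>
      (let err = (\<lambda>\<omega>. (y T \<omega>, x T \<omega>) - lf dt \<omega> N)
       in integrable P (\<lambda>\<omega>. (norm (err \<omega>))\<^sup>2) \<and>
          sqrt (\<integral>\<omega>. (norm (err \<omega>))\<^sup>2 \<partial>P) \<le> sqrt (K * integral\<^sup>L P g) * dt))"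
    unfolding Let_def by (intro allI impI main)
  then show ?thesis
    using \<delta>(1) unfolding lf_def eventually_at_right_field by blast
qed

end
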